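(* Let $n\ge1$, $A\in\mathbb R^{n\times n}$, $v,w\in\mathbb R^n$, $A_2=A+vw^\top$. Assume that no product of two eigenvalues drawn from $\sigma(A)\cup\sigma(A_2)$ (self-pairs and repeats included) equals $1$, and let $P,Q,R\in\mathbb R^{n\times n}$ be the unique solutions of $$P=APA^\top+vv^\top,\qquad Q=A_2^\top QA_2+ww^\top,\qquad R=ARA_2+vw^\top.$$ Assume that $P$, $Q$ and $I+PQ$ are nonsingular and that $\operatorname{res}(\chi_A,\chi_{A_2})\neq0$ (i.e. $A$ and $A_2$ have no common eigenvalue). Let $b(A)=\chi_{A_2}(A)\,\chi_{A_2}^*(A)^{-1}$. Then the matrix $$Z=b(A)^{-1}P$$ is invertible and satisfies $$Z\bigl(P^{-1}RQ^{-1}R^\top\bigr)Z^{-1}=(I+PQ)^{-1}.$$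
   Context: $\sigma(M)$ is the multiset of complex eigenvalues of $M$; $\chi_M(z)=\det(zI-M)$ is the characteristic polynomial, $\operatorname{res}$ is the resultant. $\chi_{A_2}(z)=\det(zI-A_2)$ and $\chi_{A_2}^*(z)=\det(I-zA_2)$ is the reciprocal polynomial (not an adjoint); $\chi_{A_2}(A)$, $\chi_{A_2}^*(A)$ denote these polynomials evaluated at the matrix $A$. Under the stated hypotheses $\chi_{A_2}^*(A)$ is invertible because $\det\chi_{A_2}^*(A)=\prod_{i,l}(1-\alpha_i\beta_l)$, where $\alpha_i$, $\beta_l$ enumerate $\sigma(A)$, $\sigma(A_2)$; $\chi_{A_2}(A)$ is invertible precisely when $\operatorname{res}(\chi_A,\chi_{A_2})\ne0$. *)

theory Defs
  imports
    Complex_Main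
    "Jordan_Normal_Form.Spectral_Radius"
    "Jordan_Normal_Form.Gauss_Jordan_Elimination"
    "Subresultants.Resultant_Prelim"
begin

definition outer_prod :: "'a::semiring_0 vec \<Rightarrow> 'a vec \<Rightarrow> 'a mat" where
  "outer_prod v w = mat (dim_vec v) (dim_vec w) (\<lambda>(i, j). v $ i * w $ j)"

text \<open>The eigenvalues of a real matrix are taken in the complex numbers.\<close>

definition cspectrum :: "real mat \<Rightarrow> complex set" where
  "cspectrum A = spectrum (map_mat complex_of_real A)"

text \<open>The reciprocal polynomial \<open>det (I - z A)\<close>, with \<open>z\<close> the polynomial variable.\<close>

definition recip_char_poly :: "'a::comm_ring_1 mat \<Rightarrow> 'a poly" where
  "recip_char_poly A =
     det (1\<^sub>m (dim_row A) - [:0, 1:] \<cdot>\<^sub>m map_mat (\<lambda>a. [:a:]) A)"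

text \<open>
  The value \<open>c\<^sub>0 I + c\<^sub>1 A + \<dots> + c\<^sub>d A\<^sup>d\<close> of a polynomial at a square matrix. The sum is written
  entrywise because the type of matrices of all dimensions has no zero matrix to sum from.
\<close>

definition poly_mat :: "'a::comm_ring_1 poly \<Rightarrow> 'a mat \<Rightarrow> 'a mat" where
  "poly_mat p A = mat (dim_row A) (dim_row A)
     (\<lambda>(i, j). \<Sum>k\<le>degree p. coeff p k * (A ^\<^sub>m k) $$ (i, j))"

text \<open>Unspecified if \<open>A\<close> is singular.\<close>

definition minv :: "'a::field mat \<Rightarrow> 'a mat" where
  "minv A = the (mat_inverse A)"

text \<open>The matrix \<open>b(A) = \<chi>\<^sub>B(A) \<chi>\<^sub>B\<^sup>*(A)\<^sup>-\<^sup>1\<close>; meaningful if \<open>\<chi>\<^sub>B\<^sup>*(A)\<close> is invertible.\<close>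

definition blaschke_mat :: "'a::field mat \<Rightarrow> 'a mat \<Rightarrow> 'a mat" where
  "blaschke_mat B A = poly_mat (char_poly B) A * minv (poly_mat (recip_char_poly B) A)"

end

theory Submission
  imports Defs
begin

text \<open>
  The Cayley transforms \<open>F = (A - I)(A + I)\<^sup>-\<^sup>1\<close> and \<open>G = (A\<^sub>2 - I)(A\<^sub>2 + I)\<^sup>-\<^sup>1\<close> exist because \<open>-1\<close> is
  not an eigenvalue. With \<open>x = \<surd>2 (A + I)\<^sup>-\<^sup>1 v\<close> and \<open>y\<^sup>T = \<surd>2 w\<^sup>T (A\<^sub>2 + I)\<^sup>-\<^sup>1\<close> one gets \<open>G = F + x y\<^sup>T\<close>,
  and the Stein equations become \<open>F P + P F\<^sup>T = -x x\<^sup>T\<close>, \<open>G\<^sup>T Q + Q G = -y y\<^sup>T\<close> and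
  \<open>F R + R G = -x y\<^sup>T\<close>. Also \<open>b(A) = p(F) p(-F)\<^sup>-\<^sup>1\<close> for the Moebius transform \<open>p\<close> of the
  characteristic polynomial of \<open>A\<^sub>2\<close>, and \<open>p(G) = 0\<close>.

  Put \<open>q = Q\<^sup>-\<^sup>1 y\<close> and \<open>u = R q - x\<close>. As \<open>Q\<close> is nonsingular, \<open>(F, y\<^sup>T)\<close> is observable, so there is
  a vector \<open>e\<close> with \<open>y\<^sup>T F\<^sup>k e = 0\<close> for \<open>k < n - 1\<close> and \<open>y\<^sup>T F\<^sup>n\<^sup>-\<^sup>1 e = 1\<close>. Evaluating \<open>p\<close> and \<open>p(-z)\<close>
  along the Krylov chains of \<open>e\<close> and \<open>R e\<close> yields \<open>b (x + q) = s x\<close> and \<open>u = -s b x\<close> with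
  \<open>s = (-1)\<^sup>n\<close>. Now \<open>P - R Q\<^sup>-\<^sup>1 R\<^sup>T\<close> and \<open>P + Q\<^sup>-\<^sup>1\<close> solve the Lyapunov equations of \<open>F\<close> with right-hand
  sides \<open>-u u\<^sup>T\<close> and \<open>-(x + q)(x + q)\<^sup>T\<close>, so that uniqueness gives \<open>P - R Q\<^sup>-\<^sup>1 R\<^sup>T = b P b\<^sup>T\<close> and
  \<open>b (P + Q\<^sup>-\<^sup>1) b\<^sup>T = P\<close>. These two identities imply the claim.
\<close>

section \<open>Matrix algebra\<close>

text \<open>
  Side conditions on dimensions, unlike those on carriers, are discharged by the simplifier
  for compound matrices too.
\<close>

lemma mult_add_mat_dim:
  fixes A :: "'a::semiring_0 mat"
  assumes "dim_col A = dim_row B" "dim_row C = dim_row B" "dim_col C = dim_col B"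
  shows "A * (B + C) = A * B + A * C"
  using assms by (intro mult_add_distrib_mat) auto

lemma add_mult_mat_dim:
  fixes A :: "'a::semiring_0 mat"
  assumes "dim_row B = dim_row A" "dim_col B = dim_col A" "dim_col A = dim_row C"
  shows "(A + B) * C = A * C + B * C"
  using assms by (intro add_mult_distrib_mat) auto

lemma mult_minus_mat_dim:
  fixes A :: "'a::ring mat"
  assumes "dim_col A = dim_row B" "dim_row C = dim_row B" "dim_col C = dim_col B"
  shows "A * (B - C) = A * B - A * C"
  using assms by (intro mult_minus_distrib_mat) auto

lemma minus_mult_mat_dim:
  fixes A :: "'a::ring mat"
  assumes "dim_row B = dim_row A" "dim_col B = dim_col A" "dim_col A = dim_row C"
  shows "(A - B) * C = A * C - B * C"
  using assms by (intro minus_mult_distrib_mat) auto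

lemma assoc_mult_mat_dim:
  fixes A :: "'a::semiring_0 mat"
  assumes "dim_col A = dim_row B" "dim_col B = dim_row C"
  shows "A * B * C = A * (B * C)"
  using assms by (intro assoc_mult_mat) auto

lemma mult_smult_mat_dim:
  fixes A :: "'a::comm_semiring_0 mat"
  assumes "dim_col A = dim_row B"
  shows "A * (k \<cdot>\<^sub>m B) = k \<cdot>\<^sub>m (A * B)"
  using assms by (intro mult_smult_distrib) auto

lemma smult_mult_mat_dim:
  fixes A :: "'a::comm_semiring_0 mat"
  assumes "dim_col A = dim_row B"
  shows "(k \<cdot>\<^sub>m A) * B = k \<cdot>\<^sub>m (A * B)"
  using assms by (intro mult_smult_assoc_mat) auto

lemma uminus_mult_mat_dim:
  fixes A :: "'a::ring mat"
  assumes "dim_col A = dim_row B"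
  shows "(- A) * B = - (A * B)" "A * (- B) = - (A * B)"
  using assms by auto

lemma assoc_mult_mat_vec_dim:
  fixes A :: "'a::semiring_0 mat"
  assumes "dim_col A = dim_row B" "dim_col B = dim_vec v"
  shows "A * B *\<^sub>v v = A *\<^sub>v (B *\<^sub>v v)"
  using assms by (intro assoc_mult_mat_vec) auto

lemma mult_add_mat_vec_dim:
  fixes A :: "'a::semiring_0 mat"
  assumes "dim_col A = dim_vec u" "dim_vec v = dim_vec u"
  shows "A *\<^sub>v (u + v) = A *\<^sub>v u + A *\<^sub>v v"
  using assms by (intro eq_vecI) (simp_all add: scalar_prod_def distrib_left sum.distrib)

lemma add_mult_mat_vec_dim:
  fixes A :: "'a::semiring_0 mat"
  assumes "dim_row B = dim_row A" "dim_col B = dim_col A" "dim_col A = dim_vec v"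
  shows "(A + B) *\<^sub>v v = A *\<^sub>v v + B *\<^sub>v v"
  using assms by (intro add_mult_distrib_mat_vec) auto

lemma mult_minus_mat_vec_dim:
  fixes A :: "'a::ring mat"
  assumes "dim_col A = dim_vec u" "dim_vec v = dim_vec u"
  shows "A *\<^sub>v (u - v) = A *\<^sub>v u - A *\<^sub>v v"
  using assms by (intro eq_vecI) (simp_all add: scalar_prod_def right_diff_distrib sum_subtractf)

lemma minus_mult_mat_vec_dim:
  fixes A :: "'a::ring mat"
  assumes "dim_row B = dim_row A" "dim_col B = dim_col A" "dim_col A = dim_vec v"
  shows "(A - B) *\<^sub>v v = A *\<^sub>v v - B *\<^sub>v v"
  using assms by (intro minus_mult_distrib_mat_vec) auto

lemma mult_mat_smult_vec_dim:
  fixes A :: "'a::comm_semiring_0 mat"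
  assumes "dim_col A = dim_vec v"
  shows "A *\<^sub>v (k \<cdot>\<^sub>v v) = k \<cdot>\<^sub>v (A *\<^sub>v v)"
  using assms by (intro eq_vecI) (auto simp: scalar_prod_def sum_distrib_left mult_ac)

lemma smult_mat_mult_vec_dim:
  fixes A :: "'a::comm_semiring_0 mat"
  assumes "dim_col A = dim_vec v"
  shows "(k \<cdot>\<^sub>m A) *\<^sub>v v = k \<cdot>\<^sub>v (A *\<^sub>v v)"
  using assms by (intro eq_vecI) (auto simp: scalar_prod_def sum_distrib_left mult_ac)

lemma uminus_mult_mat_vec_dim:
  fixes A :: "'a::ring mat"
  assumes "dim_col A = dim_vec v"
  shows "(- A) *\<^sub>v v = - (A *\<^sub>v v)" "A *\<^sub>v (- v) = - (A *\<^sub>v v)"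
  using assms by (auto intro!: eq_vecI)

lemmas mat_distribs = mult_add_mat_dim add_mult_mat_dim mult_minus_mat_dim minus_mult_mat_dim
  assoc_mult_mat_dim mult_smult_mat_dim smult_mult_mat_dim uminus_mult_mat_dim

lemmas mat_vec_distribs = assoc_mult_mat_vec_dim mult_add_mat_vec_dim add_mult_mat_vec_dim
  mult_minus_mat_vec_dim minus_mult_mat_vec_dim mult_mat_smult_vec_dim smult_mat_mult_vec_dim
  uminus_mult_mat_vec_dim

lemma transpose_mult_dim:
  fixes A :: "'a::comm_semiring_0 mat"
  assumes "dim_col A = dim_row B"
  shows "(A * B)\<^sup>T = B\<^sup>T * A\<^sup>T"
  using assms by (intro transpose_mult) auto

lemma transpose_smult: "(k \<cdot>\<^sub>m A)\<^sup>T = k \<cdot>\<^sub>m A\<^sup>T"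
  by (intro eq_matI) auto

lemma transpose_add_dim:
  assumes "dim_row B = dim_row A" "dim_col B = dim_col A"
  shows "(A + B)\<^sup>T = A\<^sup>T + B\<^sup>T"
  using assms by (intro transpose_add) auto

lemma transpose_minus_dim:
  assumes "dim_row B = dim_row A" "dim_col B = dim_col A"
  shows "(A - B)\<^sup>T = A\<^sup>T - B\<^sup>T"
  using assms by (intro transpose_minus) auto

lemmas transpose_distribs = transpose_mult_dim transpose_smult transpose_add_dim transpose_minus_dim
  transpose_uminus

lemma smult_one_mat[simp]: "(1 :: 'a::monoid_mult) \<cdot>\<^sub>m A = A"
  by (intro eq_matI) auto

lemma comm_add_mat_dim:
  fixes A :: "'a::ab_semigroup_add mat"
  assumes "dim_row B = dim_row A" "dim_col B = dim_col A"
  shows "A + B = B + A"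
  using assms by (intro eq_matI) (auto simp: add.commute)

lemma minus_self_mat[simp]: "(A :: 'a::group_add mat) - A = 0\<^sub>m (dim_row A) (dim_col A)"
  by (intro eq_matI) auto

lemma pow_mat_dim[simp]: "dim_row A = dim_col A \<Longrightarrow> dim_row (A ^\<^sub>m k) = dim_row A"
  "dim_row A = dim_col A \<Longrightarrow> dim_col (A ^\<^sub>m k) = dim_row A"
  by (induction k) auto

lemma zero_mult_vec_dim[simp]: "dim_vec v = m \<Longrightarrow> 0\<^sub>m n m *\<^sub>v v = 0\<^sub>v n"
  by (intro eq_vecI) auto

lemma one_mult_vec_dim[simp]:
  fixes v :: "'a::semiring_1 vec"
  shows "dim_vec v = n \<Longrightarrow> 1\<^sub>m n *\<^sub>v v = v"
  by (intro one_mult_mat_vec carrier_vecI)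

lemma assoc_add_vec_dim:
  fixes u :: "'a::semigroup_add vec"
  assumes "dim_vec v = dim_vec u" "dim_vec w = dim_vec u"
  shows "u + v + w = u + (v + w)"
  using assms by (intro eq_vecI) (auto simp: add.assoc)

lemma eq_if_minus_zero_mat:
  fixes X Y :: "'a::ab_group_add mat"
  assumes X: "X \<in> carrier_mat n m" and Y: "Y \<in> carrier_mat n m" and "X - Y = 0\<^sub>m n m"
  shows "X = Y"
proof -
  have "X = (X - Y) + Y" using X Y by (intro eq_matI) auto
  then show ?thesis using Y unfolding assms(3) by simp
qed

section \<open>Outer products\<close>

lemma outer_prod_dim[simp]:
  "dim_row (outer_prod v w) = dim_vec v" "dim_col (outer_prod v w) = dim_vec w"
  by (simp_all add: outer_prod_def)

lemma outer_prod_index[simp]: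
  "i < dim_vec v \<Longrightarrow> j < dim_vec w \<Longrightarrow> outer_prod v w $$ (i, j) = v $ i * w $ j"
  by (simp add: outer_prod_def)

lemma outer_prod_carrier[simp]:
  "v \<in> carrier_vec n \<Longrightarrow> w \<in> carrier_vec m \<Longrightarrow> outer_prod v w \<in> carrier_mat n m"
  by (simp add: outer_prod_def)

lemma mult_outer_prod:
  fixes M :: "'a::comm_semiring_0 mat"
  assumes "dim_col M = dim_vec v"
  shows "M * outer_prod v w = outer_prod (M *\<^sub>v v) w"
  using assms by (intro eq_matI) (auto simp: scalar_prod_def sum_distrib_left sum_distrib_right mult_ac)

lemma outer_prod_mult:
  fixes M :: "'a::comm_semiring_0 mat"
  assumes "dim_vec w = dim_row M"
  shows "outer_prod v w * M = outer_prod v (M\<^sup>T *\<^sub>v w)"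
  using assms by (intro eq_matI) (auto simp: scalar_prod_def sum_distrib_left mult_ac)

lemma outer_prod_mult_vec:
  fixes v :: "'a::comm_semiring_0 vec"
  assumes "dim_vec w = dim_vec x"
  shows "outer_prod v w *\<^sub>v x = (w \<bullet> x) \<cdot>\<^sub>v v"
  using assms by (intro eq_vecI) (auto simp: scalar_prod_def sum_distrib_left sum_distrib_right mult_ac)

lemma transpose_outer_prod:
  fixes v :: "'a::comm_semiring_0 vec"
  shows "(outer_prod v w)\<^sup>T = outer_prod w v"
  by (intro eq_matI) (auto simp: mult_ac)

section \<open>Polynomials evaluated at a matrix\<close>

lemma poly_mat_dim[simp]: "dim_row (poly_mat p A) = dim_row A" "dim_col (poly_mat p A) = dim_row A"
  by (simp_all add: poly_mat_def)

lemma poly_mat_carrier[simp]: "A \<in> carrier_mat n n \<Longrightarrow> poly_mat p A \<in> carrier_mat n n"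
  by (simp add: poly_mat_def)

text \<open>Zero coefficients are padded up to a common bound, so that polynomials of different
  degrees can be compared entrywise over one index range.\<close>

lemma poly_mat_index:
  assumes "i < dim_row A" "j < dim_row A" "degree p \<le> N"
  shows "poly_mat p A $$ (i, j) = (\<Sum>k\<le>N. coeff p k * (A ^\<^sub>m k) $$ (i, j))"
proof -
  have "(\<Sum>k\<le>N. coeff p k * (A ^\<^sub>m k) $$ (i, j)) = (\<Sum>k\<le>degree p. coeff p k * (A ^\<^sub>m k) $$ (i, j))"
    by (rule sum.mono_neutral_right) (use assms in \<open>auto simp: coeff_eq_0\<close>)
  then show ?thesis using assms by (simp add: poly_mat_def)
qed

lemma poly_mat_add: "poly_mat (p + q) A = poly_mat p A + poly_mat q A"
proof (rule eq_matI)
  fix i j assume "i < dim_row (poly_mat p A + poly_mat q A)" "j < dim_col (poly_mat p A + poly_mat q A)"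
  then have ij: "i < dim_row A" "j < dim_row A" by simp_all
  define N where "N = max (degree p) (degree q)"
  have "degree p \<le> N" "degree q \<le> N" "degree (p + q) \<le> N"
    unfolding N_def by (auto intro: degree_add_le)
  then show "poly_mat (p + q) A $$ (i, j) = (poly_mat p A + poly_mat q A) $$ (i, j)"
    using ij by (simp add: poly_mat_index[where N = N] sum.distrib algebra_simps)
qed simp_all

lemma poly_mat_smult: "poly_mat (Polynomial.smult c p) A = c \<cdot>\<^sub>m poly_mat p A"
proof (rule eq_matI)
  fix i j assume "i < dim_row (c \<cdot>\<^sub>m poly_mat p A)" "j < dim_col (c \<cdot>\<^sub>m poly_mat p A)"
  then have "i < dim_row A" "j < dim_row A" by simp_all
  moreover have "degree (Polynomial.smult c p) \<le> degree p" by (rule degree_smult_le)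
  ultimately show "poly_mat (Polynomial.smult c p) A $$ (i, j) = (c \<cdot>\<^sub>m poly_mat p A) $$ (i, j)"
    by (simp add: poly_mat_index[where N = "degree p"] sum_distrib_left algebra_simps)
qed simp_all

lemma poly_mat_0[simp]: "poly_mat 0 A = 0\<^sub>m (dim_row A) (dim_row A)"
  by (intro eq_matI) (auto simp: poly_mat_def)

lemma poly_mat_const: "A \<in> carrier_mat n n \<Longrightarrow> poly_mat [:c:] A = c \<cdot>\<^sub>m 1\<^sub>m n"
  by (intro eq_matI) (auto simp: poly_mat_def)

lemma pow_mat_Suc_left: "A \<in> carrier_mat n n \<Longrightarrow> A ^\<^sub>m Suc k = A * A ^\<^sub>m k"
proof (induction k)
  case (Suc k)
  have "A ^\<^sub>m Suc (Suc k) = A * A ^\<^sub>m k * A" using Suc by simp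
  also have "\<dots> = A * A ^\<^sub>m Suc k" using Suc.prems by (simp add: assoc_mult_mat_dim)
  finally show ?case .
qed simp

lemma poly_mat_X_mult:
  assumes A: "A \<in> carrier_mat n n"
  shows "poly_mat (pCons 0 p) A = A * poly_mat p A"
proof (rule eq_matI)
  fix i j assume "i < dim_row (A * poly_mat p A)" "j < dim_col (A * poly_mat p A)"
  then have ij: "i < n" "j < n" using A by simp_all
  have "poly_mat (pCons 0 p) A $$ (i, j) =
      (\<Sum>k\<le>Suc (degree p). coeff (pCons 0 p) k * (A ^\<^sub>m k) $$ (i, j))"
    using ij A by (intro poly_mat_index) (auto intro: degree_pCons_le)
  also have "\<dots> = (\<Sum>k\<le>degree p. coeff p k * (A ^\<^sub>m Suc k) $$ (i, j))"
    by (subst sum.atMost_Suc_shift) (simp del: pow_mat.simps)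
  also have "\<dots> = (\<Sum>k\<le>degree p. coeff p k * (\<Sum>l<n. A $$ (i, l) * (A ^\<^sub>m k) $$ (l, j)))"
    using ij A by (intro sum.cong refl)
      (simp add: pow_mat_Suc_left[OF A] scalar_prod_def atLeast0LessThan del: pow_mat.simps)
  also have "\<dots> = (\<Sum>l<n. A $$ (i, l) * (\<Sum>k\<le>degree p. coeff p k * (A ^\<^sub>m k) $$ (l, j)))"
    by (simp add: sum_distrib_left mult_ac) (rule sum.swap)
  also have "\<dots> = (A * poly_mat p A) $$ (i, j)"
    using ij A by (simp add: scalar_prod_def atLeast0LessThan poly_mat_def)
  finally show "poly_mat (pCons 0 p) A $$ (i, j) = (A * poly_mat p A) $$ (i, j)" .
qed (use assms in auto)

text \<open>The Horner recursion, on which most later inductions over polynomials rest.\<close>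

lemma poly_mat_pCons:
  assumes A: "A \<in> carrier_mat n n"
  shows "poly_mat (pCons a p) A = a \<cdot>\<^sub>m 1\<^sub>m n + A * poly_mat p A"
proof -
  have "pCons a p = [:a:] + pCons 0 p" by simp
  then show ?thesis using poly_mat_add[of "[:a:]" "pCons 0 p" A]
    by (simp add: poly_mat_const[OF A] poly_mat_X_mult[OF A] del: add_pCons)
qed

lemma poly_mat_mult:
  assumes A: "A \<in> carrier_mat n n"
  shows "poly_mat (p * q) A = poly_mat p A * poly_mat q A"
proof (induction p)
  case 0
  show ?case using A by (simp add: left_mult_zero_mat[of _ n])
next
  case (pCons a p)
  have "poly_mat (pCons a p * q) A = a \<cdot>\<^sub>m poly_mat q A + A * poly_mat (p * q) A"
    by (simp add: poly_mat_add poly_mat_smult poly_mat_X_mult[OF A])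
  then show ?case
    using A by (simp add: pCons.IH poly_mat_pCons[OF A] mat_distribs)
qed

lemma poly_mat_linear:
  assumes A: "A \<in> carrier_mat n n"
  shows "poly_mat [:a, b:] A = a \<cdot>\<^sub>m 1\<^sub>m n + b \<cdot>\<^sub>m A"
  using A by (simp add: poly_mat_pCons[OF A] mult_smult_mat_dim)

lemma poly_mat_sum_index:
  assumes "i < dim_row A" "j < dim_row A"
  shows "poly_mat (sum f S) A $$ (i, j) = (\<Sum>s\<in>S. poly_mat (f s) A $$ (i, j))"
  using assms by (induction S rule: infinite_finite_induct) (simp_all add: poly_mat_add)

text \<open>\<open>M\<close> is moved past one factor at a time. Besides similarities this covers
  commutation: for \<open>B = A\<close>, whatever commutes with \<open>A\<close> commutes with every
  polynomial in \<open>A\<close>.\<close>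

lemma poly_mat_intertwine:
  assumes A: "A \<in> carrier_mat n n" and B: "B \<in> carrier_mat m m" and M: "M \<in> carrier_mat n m"
    and AM: "A * M = M * B"
  shows "poly_mat p A * M = M * poly_mat p B"
proof (induction p)
  case 0
  show ?case using A B M by simp
next
  case (pCons a p)
  have "A * (poly_mat p A * M) = A * (M * poly_mat p B)" by (simp add: pCons.IH)
  also have "\<dots> = (A * M) * poly_mat p B" using A B M by (simp add: assoc_mult_mat_dim)
  also have "\<dots> = M * (B * poly_mat p B)" using A B M by (simp add: AM assoc_mult_mat_dim)
  finally show ?case
    using A B M by (simp add: poly_mat_pCons[OF A] poly_mat_pCons[OF B] mat_distribs)
qed

lemma poly_mat_transpose:
  assumes A: "A \<in> carrier_mat n n"
  shows "poly_mat p A\<^sup>T = (poly_mat p A)\<^sup>T"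
proof (induction p)
  case 0
  show ?case using A by simp
next
  case (pCons a p)
  have AT: "A\<^sup>T \<in> carrier_mat n n" using A by simp
  have "(poly_mat (pCons a p) A)\<^sup>T = a \<cdot>\<^sub>m 1\<^sub>m n + poly_mat p A\<^sup>T * A\<^sup>T"
    using A by (simp add: poly_mat_pCons[OF A] transpose_distribs pCons.IH)
  also have "poly_mat p A\<^sup>T * A\<^sup>T = A\<^sup>T * poly_mat p A\<^sup>T"
    using poly_mat_intertwine[OF AT AT AT] by simp
  finally show ?case by (simp add: poly_mat_pCons[OF AT])
qed

text \<open>This lets \<open>p(-F)\<close> be treated as a polynomial in \<open>F\<close> itself, so
  that it can be evaluated along the same Krylov chain as \<open>p(F)\<close>.\<close>

lemma poly_mat_pcompose_uminus:
  assumes A: "A \<in> carrier_mat n n"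
  shows "poly_mat (pcompose p [:0, -1:]) A = poly_mat p (- A)"
proof (induction p)
  case 0
  show ?case using A by simp
next
  case (pCons a p)
  have A': "- A \<in> carrier_mat n n" using A by simp
  have X: "poly_mat [:0, -1:] A = - A"
    using A by (simp add: poly_mat_linear[OF A]) (intro eq_matI, auto)
  show ?case using A
    by (simp add: pcompose_pCons poly_mat_add poly_mat_mult[OF A] poly_mat_const[OF A] X
        poly_mat_pCons[OF A'] pCons.IH del: mult_pCons_left)
qed

lemma (in comm_ring_hom) poly_mat_hom:
  assumes A: "A \<in> carrier_mat n n"
  shows "map_mat hom (poly_mat p A) = poly_mat (map_poly hom p) (map_mat hom A)"
proof (induction p)
  case 0
  show ?case using A by (intro eq_matI) auto
next
  case (pCons a p)
  have A': "map_mat hom A \<in> carrier_mat n n" using A by simp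
  have "map_mat hom (poly_mat (pCons a p) A)
      = hom a \<cdot>\<^sub>m 1\<^sub>m n + map_mat hom (A * poly_mat p A)"
    unfolding poly_mat_pCons[OF A] by (intro eq_matI) (use A in \<open>auto simp: hom_add hom_mult\<close>)
  also have "map_mat hom (A * poly_mat p A) = map_mat hom A * map_mat hom (poly_mat p A)"
    using A by (intro mat_hom_mult) auto
  finally show ?case unfolding pCons.IH map_poly_pCons_hom poly_mat_pCons[OF A'] .
qed

text \<open>Adjugate argument over the polynomial ring: for \<open>M = zI - A\<close>, the product
  \<open>M * adj_mat M\<close> is the characteristic polynomial times the identity. Substituting
  \<open>A\<close> for the variable in each entry gives block matrices whose blocks commute, and a
  suitable contraction of the blocks of \<open>M\<close> vanishes.\<close>

lemma Cayley_Hamilton: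
  fixes A :: "'a::comm_ring_1 mat"
  assumes A: "A \<in> carrier_mat n n"
  shows "poly_mat (char_poly A) A = 0\<^sub>m n n"
proof (rule eq_matI)
  fix r k assume "r < dim_row (0\<^sub>m n n :: 'a mat)" "k < dim_col (0\<^sub>m n n :: 'a mat)"
  then have rk: "r < n" "k < n" by simp_all
  define M where "M = char_poly_matrix A"
  have M: "M \<in> carrier_mat n n" using A by (simp add: M_def)
  note adj = adj_mat[OF M]
  have chi: "char_poly A = det M" by (simp add: char_poly_def M_def)
  let ?p = "\<lambda>q. poly_mat q A"
  \<comment> \<open>After the substitution, the entry \<open>(l, j)\<close> of \<open>M\<close>
    becomes the block \<open>A\<close> (if \<open>l = j\<close>) or zero, minus
    \<open>A $$ (l, j)\<close> times the identity. Contracting the column index of the block with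
    \<open>l\<close> leaves \<open>A $$ (s, j) - A $$ (s, j)\<close>.\<close>
  have ann: "(\<Sum>l<n. ?p (M $$ (l, j)) $$ (s, l)) = 0" if sj: "s < n" "j < n" for s j
  proof -
    have X: "?p [:0, 1:] = A" using A by (simp add: poly_mat_linear[OF A]) (intro eq_matI, auto)
    have M_index: "M $$ (l, j) = (if l = j then [:0, 1:] else 0) + [:- A $$ (l, j):]" if "l < n" for l
      using A that sj by (auto simp: M_def char_poly_matrix_def)
    have "?p (M $$ (l, j)) $$ (s, l) =
        (if l = j then A $$ (s, l) else 0) + (if s = l then - A $$ (l, j) else 0)" if "l < n" for l
      using A sj that by (simp add: M_index poly_mat_add X poly_mat_const[OF A] del: add_pCons)
    then have "(\<Sum>l<n. ?p (M $$ (l, j)) $$ (s, l)) =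
        (\<Sum>l<n. (if l = j then A $$ (s, l) else 0) + (if s = l then - A $$ (l, j) else 0))"
      by simp
    also have "\<dots> = A $$ (s, j) - A $$ (s, j)"
      using sj by (simp add: sum.distrib)
    finally show ?thesis by simp
  qed
  \<comment> \<open>The off-diagonal entries of \<open>M * adj_mat M\<close> are zero, so a sum over
    \<open>l\<close> can be inserted. Multiplicativity of the substitution then isolates the inner
    sum treated in \<open>ann\<close>.\<close>
  have "?p (char_poly A) $$ (r, k) = (\<Sum>l<n. if l = k then ?p (char_poly A) $$ (r, l) else 0)"
    using rk by simp
  also have "\<dots> = (\<Sum>l<n. ?p ((M * adj_mat M) $$ (l, k)) $$ (r, l))"
    using rk A unfolding chi by (intro sum.cong refl) (auto simp: adj(2))
  also have "\<dots> = (\<Sum>l<n. ?p (\<Sum>j<n. adj_mat M $$ (j, k) * M $$ (l, j)) $$ (r, l))"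
    using rk M adj(1) by (intro sum.cong refl)
      (simp add: scalar_prod_def atLeast0LessThan mult.commute[of "M $$ _"])
  also have "\<dots> = (\<Sum>l<n. \<Sum>j<n. \<Sum>s<n. ?p (adj_mat M $$ (j, k)) $$ (r, s) * ?p (M $$ (l, j)) $$ (s, l))"
    using rk A by (intro sum.cong refl)
      (simp add: poly_mat_sum_index poly_mat_mult[OF A] scalar_prod_def atLeast0LessThan)
  also have "\<dots> = (\<Sum>j<n. \<Sum>s<n. \<Sum>l<n. ?p (adj_mat M $$ (j, k)) $$ (r, s) * ?p (M $$ (l, j)) $$ (s, l))"
    by (subst sum.swap, rule sum.cong, rule refl, rule sum.swap)
  also have "\<dots> = (\<Sum>j<n. \<Sum>s<n. ?p (adj_mat M $$ (j, k)) $$ (r, s) * (\<Sum>l<n. ?p (M $$ (l, j)) $$ (s, l)))"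
    by (simp add: sum_distrib_left)
  also have "\<dots> = 0" by (simp add: ann)
  finally show "?p (char_poly A) $$ (r, k) = 0\<^sub>m n n $$ (r, k)" using rk by simp
qed (use A in auto)

lemma poly_mat_monom:
  assumes A: "A \<in> carrier_mat n n"
  shows "poly_mat (monom c k) A = c \<cdot>\<^sub>m A ^\<^sub>m k"
proof (induction k)
  case 0
  show ?case using A by (simp add: monom_0 poly_mat_const[OF A])
next
  case (Suc k)
  then show ?case
    using A by (simp add: monom_Suc poly_mat_X_mult[OF A] pow_mat_Suc_left[OF A] mult_smult_mat_dim
        del: pow_mat.simps)
qed

lemma poly_mat_power:
  assumes A: "A \<in> carrier_mat n n"
  shows "poly_mat (p ^ k) A = poly_mat p A ^\<^sub>m k"
proof (induction k)
  case 0
  show ?case using A poly_mat_const[OF A, of 1] by (simp add: one_pCons)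
next
  case (Suc k)
  have "poly_mat p A \<in> carrier_mat n n" using A by simp
  then show ?case
    by (simp add: poly_mat_mult[OF A] Suc.IH pow_mat_Suc_left del: pow_mat.simps)
qed

lemma pow_mat_mult_commute:
  fixes A :: "'a::comm_ring_1 mat"
  assumes A: "A \<in> carrier_mat n n" and B: "B \<in> carrier_mat n n" and AB: "A * B = B * A"
  shows "(A * B) ^\<^sub>m k = A ^\<^sub>m k * B ^\<^sub>m k"
proof (induction k)
  case 0
  show ?case using A B by simp
next
  case (Suc k)
  have "B ^\<^sub>m k * A = A * B ^\<^sub>m k"
    using poly_mat_intertwine[OF B B A AB[symmetric], of "monom 1 k"] A B
    by (simp add: poly_mat_monom[OF B] smult_mult_mat_dim mult_smult_mat_dim)
  then have "A ^\<^sub>m k * (B ^\<^sub>m k * A) * B = A ^\<^sub>m k * (A * B ^\<^sub>m k) * B" by simp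
  then show ?case using A B by (simp add: Suc.IH assoc_mult_mat_dim)
qed

section \<open>Matrix inverses\<close>

lemma inverse_mat_exists:
  fixes M :: "'a::field mat"
  assumes M: "M \<in> carrier_mat n n" and "det M \<noteq> 0"
  obtains N where "N \<in> carrier_mat n n" "M * N = 1\<^sub>m n" "N * M = 1\<^sub>m n"
  using det_non_zero_imp_unit[OF assms, of "()"] by (auto simp: Units_def ring_mat_simps)

lemma det_nonzero_if_inverse:
  fixes M :: "'a::field mat"
  assumes M: "M \<in> carrier_mat n n" and N: "N \<in> carrier_mat n n" and "M * N = 1\<^sub>m n"
  shows "det M \<noteq> 0"
  using det_mult[OF M N] assms(3) by auto

lemma det_pow_mat:
  fixes M :: "'a::comm_ring_1 mat"
  assumes M: "M \<in> carrier_mat n n"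
  shows "det (M ^\<^sub>m k) = det M ^ k"
proof (induction k)
  case (Suc k)
  have "M ^\<^sub>m k \<in> carrier_mat n n" using M by simp
  from det_mult[OF this M] show ?case using Suc.IH by simp
qed (use M in simp)

lemma minv_eq:
  fixes A :: "'a::field mat"
  assumes A: "A \<in> carrier_mat n n" and B: "B \<in> carrier_mat n n" and AB: "A * B = 1\<^sub>m n"
  shows "minv A = B"
proof -
  have BA: "B * A = 1\<^sub>m n" by (rule mat_mult_left_right_inverse[OF A B AB])
  have "mat_inverse A \<noteq> None"
    using mat_inverse(1)[OF A, of "()"] A B AB BA by (auto simp: Units_def ring_mat_simps)
  then obtain C where C: "mat_inverse A = Some C" by blast
  from mat_inverse(2)[OF A C] have CA: "C * A = 1\<^sub>m n" and C': "C \<in> carrier_mat n n" by auto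
  have "C = C * (A * B)" using AB C' by simp
  also have "\<dots> = C * A * B" using A B C' by simp
  also have "\<dots> = B" using CA B by simp
  finally show ?thesis by (simp add: minv_def C)
qed

lemma invertible_matI:
  fixes A :: "'a::field mat"
  assumes A: "A \<in> carrier_mat n n" and B: "B \<in> carrier_mat n n" and AB: "A * B = 1\<^sub>m n"
  shows "invertible_mat A"
  using mat_mult_left_right_inverse[OF A B AB] A B AB
  by (auto simp: invertible_mat_def inverts_mat_def)

lemma invertible_matE:
  fixes A :: "'a::field mat"
  assumes A: "A \<in> carrier_mat n n" and inv: "invertible_mat A"
  obtains B where "B \<in> carrier_mat n n" "A * B = 1\<^sub>m n" "B * A = 1\<^sub>m n" "minv A = B"
proof -
  obtain B where B: "A * B = 1\<^sub>m (dim_row A)" "B * A = 1\<^sub>m (dim_row B)"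
    using inv by (auto simp: invertible_mat_def inverts_mat_def)
  \<comment> \<open>\<open>invertible_mat\<close> leaves the shape of \<open>B\<close> open;
    comparing column counts in the two identities forces it to be square of size
    \<open>n\<close>.\<close>
  have "dim_col (A * B) = n" "dim_col (B * A) = dim_row B"
    using A B by simp_all
  then have Bn: "B \<in> carrier_mat n n" using A by auto
  with A B have "A * B = 1\<^sub>m n" "B * A = 1\<^sub>m n" by auto
  then show ?thesis using that[OF Bn] minv_eq[OF A Bn] by blast
qed

lemma det_nonzero_left_cancel:
  fixes M :: "'a::field mat"
  assumes M: "M \<in> carrier_mat n n" and "det M \<noteq> 0" and X: "X \<in> carrier_mat n m" and Y: "Y \<in> carrier_mat n m"
    and eq: "M * X = M * Y"
  shows "X = Y"
proof -
  obtain N where N: "N \<in> carrier_mat n n" "N * M = 1\<^sub>m n"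
    using inverse_mat_exists[OF M \<open>det M \<noteq> 0\<close>] by blast
  have "N * (M * X) = X" "N * (M * Y) = Y"
    using N M X Y by (simp_all add: assoc_mult_mat_dim[symmetric] del: assoc_mult_mat)
  then show ?thesis using eq by metis
qed

section \<open>The reciprocal characteristic polynomial\<close>

text \<open>For \<open>degree p \<le> m\<close> this is \<open>z^m p(1/z)\<close>, the reversal at a
  nominal degree \<open>m\<close>. \<open>reflect_poly\<close> reverses at the actual degree, which
  does not behave uniformly in an induction that strips one coefficient and lowers \<open>m\<close>
  by one.\<close>

definition reflect_at :: "nat \<Rightarrow> 'a::comm_monoid_add poly \<Rightarrow> 'a poly" where
  "reflect_at m p = (\<Sum>k\<le>m. monom (coeff p (m - k)) k)"

lemma coeff_reflect_at: "coeff (reflect_at m p) k = (if k \<le> m then coeff p (m - k) else 0)"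
  by (simp add: reflect_at_def coeff_sum)

lemma reflect_at_0: "reflect_at 0 p = [:coeff p 0:]"
  by (simp add: reflect_at_def monom_0)

lemma reflect_at_Suc_pCons: "reflect_at (Suc m) (pCons a p) = reflect_at m p + monom a (Suc m)"
  by (intro poly_eqI) (auto simp: coeff_reflect_at coeff_pCons Suc_diff_le split: nat.splits)

lemma reflect_at_degree: "reflect_at (degree p) p = reflect_poly p"
  by (intro poly_eqI) (simp add: coeff_reflect_at coeff_reflect_poly)

text \<open>For nonzero \<open>x\<close>, \<open>det(I - xB) = x^n det(x^-1 I - B)\<close>, and the
  characteristic polynomial has degree exactly \<open>n\<close>.\<close>

lemma recip_char_poly_eq:
  fixes B :: "'a::field_char_0 mat"
  assumes B: "B \<in> carrier_mat n n"
  shows "recip_char_poly B = reflect_poly (char_poly B)"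
proof -
  have deg: "degree (char_poly B) = n" using degree_monic_char_poly[OF B] by simp
  have eq: "poly (recip_char_poly B) x = poly (reflect_poly (char_poly B)) x" if "x \<noteq> 0" for x
  proof -
    have "poly (recip_char_poly B) x = det (1\<^sub>m n - x \<cdot>\<^sub>m B)"
      unfolding recip_char_poly_def using B by (intro poly_det_cong[of _ n]) auto
    also have "1\<^sub>m n - x \<cdot>\<^sub>m B = x \<cdot>\<^sub>m (inverse x \<cdot>\<^sub>m 1\<^sub>m n - B)"
      using B that by (intro eq_matI) (auto simp: field_simps)
    also have "det \<dots> = x ^ n * det (inverse x \<cdot>\<^sub>m 1\<^sub>m n - B)"
      using B by simp
    also have "det (inverse x \<cdot>\<^sub>m 1\<^sub>m n - B) = poly (char_poly B) (inverse x)"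
      unfolding char_poly_defs using B by (intro poly_det_cong[of _ n, symmetric]) auto
    finally show ?thesis using that by (simp add: poly_reflect_poly_nz deg)
  qed
  \<comment> \<open>The pointwise comparison is available only away from 0. The additional factor
    \<open>z\<close> makes the difference vanish at 0 as well and is cancelled afterwards.\<close>
  have "poly ([:0, 1:] * (recip_char_poly B - reflect_poly (char_poly B))) x = 0" for x
    using eq[of x] by (cases "x = 0") auto
  then have "[:0, 1:] * (recip_char_poly B - reflect_poly (char_poly B)) = 0"
    using poly_all_0_iff_0 by blast
  then show ?thesis by simp
qed

text \<open>The polynomial splits into linear factors over the complex numbers, and each factor
  \<open>A - zI\<close> is nonsingular because its root \<open>z\<close> lies outside the
  spectrum.\<close>

lemma det_poly_mat_nonzero:
  fixes A :: "complex mat"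
  assumes A: "A \<in> carrier_mat n n" and "p \<noteq> 0"
    and "\<And>z. z \<in> spectrum A \<Longrightarrow> poly p z \<noteq> 0"
  shows "det (poly_mat p A) \<noteq> 0"
  using assms(2,3)
proof (induction "degree p" arbitrary: p)
  case 0
  then obtain c where "p = [:c:]" "c \<noteq> 0" by (metis degree_eq_zeroE pCons_0_0)
  then show ?case using A by (simp add: poly_mat_const[OF A])
next
  case (Suc d)
  then have "\<not> constant (poly p)" by (simp add: constant_degree)
  then obtain z where z: "poly p z = 0" using fundamental_theorem_of_algebra by blast
  then obtain q where p: "p = [:- z, 1:] * q" using poly_eq_0_iff_dvd by (metis dvdE)
  have "q \<noteq> 0" using Suc.prems p by auto
  then have "d = degree q" using Suc.hyps(2) unfolding p by (subst (asm) degree_mult_eq) auto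
  moreover have "poly q x \<noteq> 0" if "x \<in> spectrum A" for x using Suc.prems(2)[OF that] p by simp
  ultimately have q: "det (poly_mat q A) \<noteq> 0" using Suc.hyps(1) \<open>q \<noteq> 0\<close> by blast
  have "z \<notin> spectrum A" using Suc.prems(2) z by blast
  then have "det (char_matrix A z) \<noteq> 0"
    by (simp add: spectrum_def eigenvalue_det[OF A])
  also have "char_matrix A z = poly_mat [:- z, 1:] A"
    using A by (simp only: poly_mat_linear[OF A]) (intro eq_matI, auto simp: char_matrix_def)
  finally show ?case
    using q A unfolding p poly_mat_mult[OF A] by (subst det_mult) auto
qed

text \<open>After complexification, the roots of the reciprocal polynomial are the inverses of the
  nonzero eigenvalues of \<open>B\<close>, and the hypothesis keeps these out of the spectrum of
  \<open>A\<close>.\<close>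

lemma det_recip_char_poly_nonzero:
  fixes A B :: "real mat"
  assumes A: "A \<in> carrier_mat n n" and B: "B \<in> carrier_mat n n"
    and ne: "\<And>a b. a \<in> cspectrum A \<Longrightarrow> b \<in> cspectrum B \<Longrightarrow> a * b \<noteq> 1"
  shows "det (poly_mat (recip_char_poly B) A) \<noteq> 0"
proof -
  let ?c = "map_mat complex_of_real"
  have cA: "?c A \<in> carrier_mat n n" and cB: "?c B \<in> carrier_mat n n" using A B by simp_all
  define p where "p = map_poly complex_of_real (recip_char_poly B)"
  have p: "p = reflect_poly (char_poly (?c B))"
    unfolding p_def recip_char_poly_eq[OF B] of_real_hom.char_poly_hom[OF B]
    by (intro poly_eqI) (simp add: coeff_reflect_poly)
  have lead: "lead_coeff (char_poly (?c B)) = 1" using degree_monic_char_poly[OF cB] by auto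
  then have "p \<noteq> 0" unfolding p by (metis leading_coeff_0_iff reflect_poly_eq_0_iff zero_neq_one)
  moreover have "poly p z \<noteq> 0" if z: "z \<in> spectrum (?c A)" for z
  \<comment> \<open>At 0 the reflected polynomial takes the value of the leading coefficient of a
    characteristic polynomial, which is 1.\<close>
  proof (cases "z = 0")
    case True
    then show ?thesis using lead by (simp add: p)
  next
    case False
    have "inverse z \<notin> spectrum (?c B)"
      using ne[of z "inverse z"] z False by (auto simp: cspectrum_def)
    then show ?thesis
      using False by (simp add: p poly_reflect_poly_nz spectrum_root_char_poly[OF cB])
  qed
  ultimately have "det (poly_mat p (?c A)) \<noteq> 0" by (intro det_poly_mat_nonzero[OF cA]) auto
  also have "poly_mat p (?c A) = ?c (poly_mat (recip_char_poly B) A)"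
    unfolding p_def by (rule of_real_hom.poly_mat_hom[OF A, symmetric])
  finally show ?thesis by (simp add: of_real_hom.hom_det)
qed

section \<open>The Stein equation\<close>

text \<open>Iterating \<open>X = A X B\<close> gives \<open>A^(m-k) X = A^m X B^k\<close> for
  \<open>k \<le> m\<close>; the claim is the combination of these with the coefficients of
  \<open>p\<close>.\<close>

lemma reflect_at_stein:
  fixes A :: "'a::comm_ring_1 mat"
  assumes A: "A \<in> carrier_mat n n" and B: "B \<in> carrier_mat n n" and X: "X \<in> carrier_mat n n"
    and eq: "A * X * B = X" and "degree p \<le> m"
  shows "poly_mat (reflect_at m p) A * X = A ^\<^sub>m m * X * poly_mat p B"
  using \<open>degree p \<le> m\<close>
proof (induction m arbitrary: p)
  case 0
  then obtain c where "p = [:c:]" by (metis degree_eq_zeroE le_zero_eq)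
  then show ?case using A B X
    by (simp add: reflect_at_0 poly_mat_const[OF A] poly_mat_const[OF B] mat_distribs)
next
  case (Suc m)
  obtain a q where p: "p = pCons a q" by (cases p)
  have "degree q \<le> m" using Suc.prems p by (cases "q = 0") auto
  note IH = Suc.IH[OF this]
  have "A ^\<^sub>m m * (A * X * B) * poly_mat q B = A ^\<^sub>m m * X * poly_mat q B" by (simp add: eq)
  then show ?case using A B X IH
    by (simp add: p reflect_at_Suc_pCons poly_mat_add poly_mat_monom[OF A] poly_mat_pCons[OF B] mat_distribs
        comm_add_mat_dim)
qed

text \<open>For \<open>p\<close> the characteristic polynomial of \<open>B\<close>, Cayley-Hamilton
  kills the right-hand side of \<open>reflect_at_stein\<close>, while the left factor is
  invertible.\<close>

lemma stein_unique:
  fixes A :: "'a::field_char_0 mat"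
  assumes A: "A \<in> carrier_mat n n" and B: "B \<in> carrier_mat n n" and X: "X \<in> carrier_mat n n"
    and det: "det (poly_mat (recip_char_poly B) A) \<noteq> 0" and eq: "A * X * B = X"
  shows "X = 0\<^sub>m n n"
proof -
  have deg: "degree (char_poly B) = n" using degree_monic_char_poly[OF B] by simp
  then have "poly_mat (recip_char_poly B) A * X = A ^\<^sub>m n * X * poly_mat (char_poly B) B"
    using reflect_at_stein[OF A B X eq, of "char_poly B" n] reflect_at_degree[of "char_poly B"]
    by (simp add: recip_char_poly_eq[OF B])
  also have "\<dots> = poly_mat (recip_char_poly B) A * 0\<^sub>m n n"
    using A B X by (simp add: Cayley_Hamilton[OF B])
  finally have eq0: "poly_mat (recip_char_poly B) A * X = poly_mat (recip_char_poly B) A * 0\<^sub>m n n" .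
  show ?thesis
    by (rule det_nonzero_left_cancel[OF _ det X _ eq0]) (use A in simp_all)
qed

text \<open>A telescoping sum: \<open>A^(m-k) C - A^m C B^k\<close> is the sum of
  \<open>Z - A Z B\<close> over \<open>Z = A^(m-k+i) C B^i\<close> with \<open>i < k\<close>. It is
  the inhomogeneous counterpart of \<open>reflect_at_stein\<close> and serves existence instead of
  uniqueness.\<close>

lemma reflect_at_stein_sum:
  fixes A :: "'a::comm_ring_1 mat"
  assumes A: "A \<in> carrier_mat n n" and B: "B \<in> carrier_mat n n" and C: "C \<in> carrier_mat n n"
    and "degree p \<le> m"
  shows "\<exists>Y\<in>carrier_mat n n.
    Y - A * Y * B = poly_mat (reflect_at m p) A * C - A ^\<^sub>m m * C * poly_mat p B"
  using \<open>degree p \<le> m\<close>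
proof (induction m arbitrary: p)
  case 0
  then obtain c where "p = [:c:]" by (metis degree_eq_zeroE le_zero_eq)
  then have "0\<^sub>m n n - A * 0\<^sub>m n n * B = poly_mat (reflect_at 0 p) A * C - A ^\<^sub>m 0 * C * poly_mat p B"
    using A B C
    by (simp add: reflect_at_0 poly_mat_const[OF A] poly_mat_const[OF B] mat_distribs)
  then show ?case by auto
next
  case (Suc m)
  obtain a q where p: "p = pCons a q" by (cases p)
  have "degree q \<le> m" using Suc.prems p by (cases "q = 0") auto
  then obtain Y where Y: "Y \<in> carrier_mat n n"
    and eq: "Y - A * Y * B = poly_mat (reflect_at m q) A * C - A ^\<^sub>m m * C * poly_mat q B"
    using Suc.IH by blast
  \<comment> \<open>The added term cancels the old remainder \<open>A^m C q(B)\<close> and creates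
    \<open>A^(m+1) C q(B) B\<close>. The constant coefficient \<open>a\<close> contributes
    \<open>a A^(m+1) C\<close> to both parts of the new right-hand side and drops out.\<close>
  define Y' where "Y' = Y + A ^\<^sub>m m * C * poly_mat q B"
  have comm: "B * poly_mat q B = poly_mat q B * B"
    using poly_mat_intertwine[OF B B B refl, of q] by simp
  have Y': "Y' \<in> carrier_mat n n" unfolding Y'_def using Y A B C by (intro carrier_matI) simp_all
  have "Y' - A * Y' * B = (Y - A * Y * B) + (A ^\<^sub>m m * C * poly_mat q B - A ^\<^sub>m Suc m * C * poly_mat q B * B)"
    unfolding Y'_def pow_mat_Suc_left[OF A] using A B C Y
    by (intro eq_matI) (simp_all add: mat_distribs del: index_mult_mat(1))
  also have "\<dots> = poly_mat (reflect_at m q) A * C - A ^\<^sub>m Suc m * C * (poly_mat q B * B)"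
    unfolding eq using A B C
    by (intro eq_matI) (simp_all add: mat_distribs del: index_mult_mat(1))
  also have "\<dots> = poly_mat (reflect_at (Suc m) p) A * C - A ^\<^sub>m Suc m * C * poly_mat p B"
    unfolding p reflect_at_Suc_pCons poly_mat_add poly_mat_monom[OF A] poly_mat_pCons[OF B] comm[symmetric]
    using A B C
    by (intro eq_matI) (simp_all add: mat_distribs del: index_mult_mat(1) pow_mat.simps)
  finally show ?case using Y' by blast
qed

text \<open>By Cayley-Hamilton the telescoping lemma solves the equation with \<open>M * C\<close>
  in place of \<open>C\<close>. The inverse of \<open>M\<close> commutes with \<open>A\<close>, so
  multiplying that solution by it restores the right-hand side \<open>C\<close>.\<close>

lemma stein_exists:
  fixes A :: "'a::field_char_0 mat"
  assumes A: "A \<in> carrier_mat n n" and B: "B \<in> carrier_mat n n" and C: "C \<in> carrier_mat n n"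
    and det: "det (poly_mat (recip_char_poly B) A) \<noteq> 0"
  shows "\<exists>X\<in>carrier_mat n n. X = A * X * B + C"
proof -
  define M where "M = poly_mat (recip_char_poly B) A"
  have M: "M \<in> carrier_mat n n" "det M \<noteq> 0" using A det by (simp_all add: M_def)
  have deg: "degree (char_poly B) = n" using degree_monic_char_poly[OF B] by simp
  then have M_eq: "poly_mat (reflect_at n (char_poly B)) A = M"
    using reflect_at_degree[of "char_poly B"] by (simp add: M_def recip_char_poly_eq[OF B])
  obtain Y where Y: "Y \<in> carrier_mat n n"
    and "Y - A * Y * B = M * C - A ^\<^sub>m n * C * poly_mat (char_poly B) B"
    using reflect_at_stein_sum[OF A B C, of "char_poly B" n] deg unfolding M_eq by auto
  then have eq: "Y - A * Y * B = M * C"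
    using A B C M by (simp add: Cayley_Hamilton[OF B]) (intro eq_matI, auto)
  obtain N where N: "N \<in> carrier_mat n n" "M * N = 1\<^sub>m n" "N * M = 1\<^sub>m n"
    using inverse_mat_exists[OF M] by blast
  have "N * A = N * A * (M * N)" using N A by simp
  also have "\<dots> = N * (A * M) * N" using N(1) A M by (simp add: assoc_mult_mat_dim)
  also have "A * M = M * A"
    unfolding M_def by (rule poly_mat_intertwine[OF A A A HOL.refl, symmetric])
  also have "N * (M * A) * N = (N * M) * (A * N)"
    using N(1) A M by (simp add: assoc_mult_mat_dim)
  also have "\<dots> = A * N" unfolding N(3) using N(1) A by simp
  finally have comm: "N * A = A * N" .
  have "N * Y - N * A * Y * B = N * (Y - A * Y * B)"
    using N A B Y by (simp add: mat_distribs)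
  also have "\<dots> = C" unfolding eq using N M C by (simp add: assoc_mult_mat_dim[symmetric] del: assoc_mult_mat)
  finally have *: "N * Y - A * N * Y * B = C" unfolding comm .
  have "N * Y = A * (N * Y) * B + C"
    unfolding *[symmetric] using N A B Y
    by (intro eq_matI) (simp_all add: mat_distribs del: index_mult_mat(1))
  then show ?thesis using N Y by (intro bexI[of _ "N * Y"]) auto
qed

section \<open>Moebius transformation of polynomials\<close>

text \<open>This is \<open>(1-z)^m p((1+z)/(1-z))\<close>, the Moebius transform with denominators
  cleared at the nominal degree \<open>m\<close>.\<close>

definition cayley_poly :: "nat \<Rightarrow> 'a::comm_ring_1 poly \<Rightarrow> 'a poly" where
  "cayley_poly m p = (\<Sum>k\<le>m. Polynomial.smult (coeff p k) ([:1, 1:] ^ k * [:1, -1:] ^ (m - k)))"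

lemma cayley_poly_0: "cayley_poly 0 p = [:coeff p 0:]"
  by (simp add: cayley_poly_def)

lemma cayley_poly_Suc_pCons:
  "cayley_poly (Suc m) (pCons a p) =
    Polynomial.smult a ([:1, -1:] ^ Suc m) + [:1, 1:] * cayley_poly m p"
  unfolding cayley_poly_def
  by (subst sum.atMost_Suc_shift) (simp add: sum_distrib_left mult_ac del: mult_pCons_left mult_pCons_right)

lemma degree_cayley_poly: "degree (cayley_poly m (p :: 'a::idom poly)) \<le> m"
proof -
  have "degree ([:1, 1:] ^ k * [:1, -1:] ^ (m - k) :: 'a poly) \<le> m" if "k \<le> m" for k
    using that by (subst degree_mult_eq) (auto simp: degree_power_eq)
  then show ?thesis
    unfolding cayley_poly_def by (intro degree_sum_le) (auto intro: order_trans[OF degree_smult_le])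
qed

text \<open>The summand of index \<open>k\<close> contributes its top coefficient
  \<open>(-1)^(m-k)\<close>, so the total is a value of \<open>p\<close> at -1. It is nonzero
  exactly when -1 is not a root of \<open>p\<close>.\<close>

lemma coeff_cayley_poly:
  "degree p \<le> m \<Longrightarrow> coeff (cayley_poly m (p :: 'a::idom poly)) m = (-1) ^ m * poly p (-1)"
proof (induction m arbitrary: p)
  case 0
  then obtain c where "p = [:c:]" by (metis degree_eq_zeroE le_zero_eq)
  then show ?case by (simp add: cayley_poly_0)
next
  case (Suc m)
  obtain a q where p: "p = pCons a q" by (cases p)
  have "degree q \<le> m" using Suc.prems p by (cases "q = 0") auto
  note IH = Suc.IH[OF this]
  have lin: "coeff ([:1, -1:] ^ k :: 'a poly) k = (-1) ^ k" for k
    using lead_coeff_power[of "[:1, -1:] :: 'a poly" k] by (simp add: degree_power_eq)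
  have "coeff (cayley_poly m q) (Suc m) = 0"
    using degree_cayley_poly[of m q] by (simp add: coeff_eq_0)
  then show ?case
    using lin[of "Suc m"] by (simp add: p cayley_poly_Suc_pCons IH algebra_simps)
qed

text \<open>With \<open>J = I - F\<close> the hypothesis reads \<open>I + F = A J\<close>, so the
  two linear factors of \<open>cayley_poly\<close> become \<open>A J\<close> and \<open>J\<close>.
  Replacing \<open>F\<close> by \<open>- F\<close> exchanges them, which reverses the coefficients
  of \<open>p\<close>.\<close>

lemma poly_mat_cayley_poly:
  fixes A F :: "'a::idom mat"
  assumes A: "A \<in> carrier_mat n n" and F: "F \<in> carrier_mat n n" and AF: "A * F = F * A"
    and cayley: "1\<^sub>m n + F = A * (1\<^sub>m n - F)" and "degree p \<le> m"
  shows "poly_mat (cayley_poly m p) F = poly_mat p A * (1\<^sub>m n - F) ^\<^sub>m m"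
    and "poly_mat (cayley_poly m p) (- F) = poly_mat (reflect_at m p) A * (1\<^sub>m n - F) ^\<^sub>m m"
proof -
  define J where "J = 1\<^sub>m n - F"
  have J: "J \<in> carrier_mat n n" and F': "- F \<in> carrier_mat n n" using F by (auto simp: J_def)
  have AJ: "A * J = J * A" using A F AF by (simp add: J_def mat_distribs)
  have lin: "poly_mat [:1, 1:] F = A * J" "poly_mat [:1, -1:] F = J"
      "poly_mat [:1, 1:] (- F) = J" "poly_mat [:1, -1:] (- F) = A * J"
    unfolding J_def cayley[symmetric] poly_mat_linear[OF F] poly_mat_linear[OF F']
    using F by (auto intro!: eq_matI)
  have comm: "poly_mat q A * J = J * poly_mat q A" for q
    by (rule poly_mat_intertwine[OF A A J AJ])
  have "poly_mat (cayley_poly m p) F = poly_mat p A * J ^\<^sub>m m \<and>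
      poly_mat (cayley_poly m p) (- F) = poly_mat (reflect_at m p) A * J ^\<^sub>m m"
    using \<open>degree p \<le> m\<close>
  proof (induction m arbitrary: p)
    case 0
    then obtain c where "p = [:c:]" by (metis degree_eq_zeroE le_zero_eq)
    then show ?case using A F J
      by (simp add: cayley_poly_0 reflect_at_0 poly_mat_const[OF A] poly_mat_const[OF F] poly_mat_const[OF F'])
  next
    case (Suc m)
    obtain a q where p: "p = pCons a q" by (cases p)
    have "degree q \<le> m" using Suc.prems p by (cases "q = 0") auto
    note IH = Suc.IH[OF this]
    have "poly_mat (cayley_poly (Suc m) p) F = a \<cdot>\<^sub>m J ^\<^sub>m Suc m + A * J * (poly_mat q A * J ^\<^sub>m m)"
      using IH by (simp only: p cayley_poly_Suc_pCons poly_mat_add poly_mat_smult poly_mat_mult[OF F]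
          poly_mat_power[OF F] lin)
    also have "A * J * (poly_mat q A * J ^\<^sub>m m) = A * (J * poly_mat q A) * J ^\<^sub>m m"
      using A J by (simp add: assoc_mult_mat_dim)
    also have "\<dots> = A * poly_mat q A * J ^\<^sub>m Suc m"
      unfolding comm[symmetric] pow_mat_Suc_left[OF J] using A J by (simp add: assoc_mult_mat_dim)
    finally have 1: "poly_mat (cayley_poly (Suc m) p) F = poly_mat p A * J ^\<^sub>m Suc m"
      using A J by (simp add: p poly_mat_pCons[OF A] mat_distribs del: pow_mat.simps)
    have "poly_mat (cayley_poly (Suc m) p) (- F) =
        a \<cdot>\<^sub>m (A * J) ^\<^sub>m Suc m + J * (poly_mat (reflect_at m q) A * J ^\<^sub>m m)"
      using IH by (simp only: p cayley_poly_Suc_pCons poly_mat_add poly_mat_smult poly_mat_mult[OF F']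
          poly_mat_power[OF F'] lin)
    also have "J * (poly_mat (reflect_at m q) A * J ^\<^sub>m m) = (J * poly_mat (reflect_at m q) A) * J ^\<^sub>m m"
      using A J by (simp add: assoc_mult_mat_dim)
    also have "\<dots> = poly_mat (reflect_at m q) A * J ^\<^sub>m Suc m"
      unfolding comm[symmetric] pow_mat_Suc_left[OF J] using A J by (simp add: assoc_mult_mat_dim)
    also have "(A * J) ^\<^sub>m Suc m = A ^\<^sub>m Suc m * J ^\<^sub>m Suc m"
      by (rule pow_mat_mult_commute[OF A J AJ])
    finally have 2: "poly_mat (cayley_poly (Suc m) p) (- F) = poly_mat (reflect_at (Suc m) p) A * J ^\<^sub>m Suc m"
      using A J by (simp add: p reflect_at_Suc_pCons poly_mat_add poly_mat_monom[OF A] mat_distribs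
          comm_add_mat_dim del: pow_mat.simps)
    show ?case using 1 2 by simp
  qed
  then show "poly_mat (cayley_poly m p) F = poly_mat p A * (1\<^sub>m n - F) ^\<^sub>m m"
    "poly_mat (cayley_poly m p) (- F) = poly_mat (reflect_at m p) A * (1\<^sub>m n - F) ^\<^sub>m m"
    by (simp_all add: J_def)
qed

section \<open>Krylov chains\<close>

lemma scalar_prod_poly_mat:
  fixes F :: "'a::comm_ring_1 mat"
  assumes F: "F \<in> carrier_mat n n" and y: "y \<in> carrier_vec n" and z: "z \<in> carrier_vec n"
    and "degree p < N"
  shows "y \<bullet> (poly_mat p F *\<^sub>v z) = (\<Sum>k<N. coeff p k * (y \<bullet> (F ^\<^sub>m k *\<^sub>v z)))"
proof -
  have N: "{..N - Suc 0} = {..<N}" using \<open>degree p < N\<close> by auto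
  have "y \<bullet> (poly_mat p F *\<^sub>v z) =
      (\<Sum>i<n. \<Sum>j<n. \<Sum>k<N. y $ i * (coeff p k * (F ^\<^sub>m k) $$ (i, j) * z $ j))"
    using F y z \<open>degree p < N\<close>
    by (simp add: scalar_prod_def atLeast0LessThan poly_mat_index[where N = "N - Suc 0"] N
        sum_distrib_left sum_distrib_right)
  also have "\<dots> = (\<Sum>i<n. \<Sum>k<N. \<Sum>j<n. y $ i * (coeff p k * (F ^\<^sub>m k) $$ (i, j) * z $ j))"
    by (rule sum.cong, rule refl, rule sum.swap)
  also have "\<dots> = (\<Sum>k<N. \<Sum>i<n. \<Sum>j<n. y $ i * (coeff p k * (F ^\<^sub>m k) $$ (i, j) * z $ j))"
    by (rule sum.swap)
  also have "\<dots> = (\<Sum>k<N. coeff p k * (y \<bullet> (F ^\<^sub>m k *\<^sub>v z)))"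
    using F y z
    by (simp add: scalar_prod_def atLeast0LessThan sum_distrib_left mult_ac)
  finally show ?thesis .
qed

text \<open>Observability makes the matrix \<open>M\<close> with rows \<open>y^T F^i\<close>
  injective, hence invertible; \<open>e\<close> is the last column of its inverse.\<close>

lemma krylov_dual_vector:
  fixes F :: "'a::field mat"
  assumes F: "F \<in> carrier_mat n n" and y: "y \<in> carrier_vec n" and n: "n > 0"
    and obs: "\<And>z. z \<in> carrier_vec n \<Longrightarrow>
      (\<And>p. degree p < n \<Longrightarrow> y \<bullet> (poly_mat p F *\<^sub>v z) = 0) \<Longrightarrow> z = 0\<^sub>v n"
  obtains e where "e \<in> carrier_vec n"
    "\<And>p. degree p < n \<Longrightarrow> y \<bullet> (poly_mat p F *\<^sub>v e) = coeff p (n - 1)"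
proof -
  define M where "M = mat n n (\<lambda>(i, j). ((F ^\<^sub>m i)\<^sup>T *\<^sub>v y) $ j)"
  have M: "M \<in> carrier_mat n n" by (simp add: M_def)
  have M_mult: "(M *\<^sub>v z) $ i = y \<bullet> (F ^\<^sub>m i *\<^sub>v z)" if "z \<in> carrier_vec n" "i < n" for z i
  proof -
    have Fi: "F ^\<^sub>m i \<in> carrier_mat n n" using F by simp
    have "row M i = (F ^\<^sub>m i)\<^sup>T *\<^sub>v y" using Fi \<open>i < n\<close> y by (intro eq_vecI) (auto simp: M_def)
    then have "(M *\<^sub>v z) $ i = ((F ^\<^sub>m i)\<^sup>T *\<^sub>v y) \<bullet> z" using M \<open>i < n\<close> by simp
    then show ?thesis using transpose_vec_mult_scalar[OF Fi \<open>z \<in> _\<close> y] by simp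
  qed
  have "det M \<noteq> 0"
  proof
    assume "det M = 0"
    then obtain z where z: "z \<in> carrier_vec n" "z \<noteq> 0\<^sub>v n" "M *\<^sub>v z = 0\<^sub>v n"
      using det_0_iff_vec_prod_zero_field[OF M] by blast
    then have "y \<bullet> (F ^\<^sub>m k *\<^sub>v z) = 0" if "k < n" for k
      using M_mult[OF z(1) that] that by simp
    then have "y \<bullet> (poly_mat p F *\<^sub>v z) = 0" if "degree p < n" for p
      by (simp add: scalar_prod_poly_mat[OF F y z(1) that])
    then show False using obs z by blast
  qed
  then obtain N where N: "N \<in> carrier_mat n n" "M * N = 1\<^sub>m n" by (rule inverse_mat_exists[OF M])
  define e where "e = N *\<^sub>v unit_vec n (n - 1)"
  have e: "e \<in> carrier_vec n" using N(1) by (simp add: e_def)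
  have "M *\<^sub>v e = (M * N) *\<^sub>v unit_vec n (n - 1)"
    unfolding e_def using M N(1) by (simp add: assoc_mult_mat_vec_dim)
  then have "M *\<^sub>v e = unit_vec n (n - 1)" by (simp add: N(2))
  then have *: "y \<bullet> (F ^\<^sub>m k *\<^sub>v e) = (if k = n - 1 then 1 else 0)" if "k < n" for k
    using M_mult[OF e that] that by simp
  have "y \<bullet> (poly_mat p F *\<^sub>v e) = coeff p (n - 1)" if "degree p < n" for p
  proof -
    have "y \<bullet> (poly_mat p F *\<^sub>v e) = (\<Sum>k<n. if k = n - 1 then coeff p k else 0)"
      unfolding scalar_prod_poly_mat[OF F y e that] using * by (intro sum.cong) auto
    then show ?thesis using n by simp
  qed
  then show ?thesis using that e by blast
qed

text \<open>
  The intertwining defect of \<open>\<Phi>\<close> is of rank one with row vector \<open>y\<close>, and \<open>y\<close> annihilates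
  \<open>e, F e, \<dots>, F\<^sup>n\<^sup>-\<^sup>2 e\<close>. So the defect is felt only in degree \<open>n\<close>.
\<close>

lemma krylov_chain:
  fixes F S \<Phi> :: "'a::comm_ring_1 mat"
  assumes F: "F \<in> carrier_mat n n" and S: "S \<in> carrier_mat n n" and \<Phi>: "\<Phi> \<in> carrier_mat n n"
    and y: "y \<in> carrier_vec n" and u: "u \<in> carrier_vec n" and e: "e \<in> carrier_vec n" and n: "n > 0"
    and defect: "\<Phi> * F = S * \<Phi> + outer_prod u y"
    and dual: "\<And>p. degree p < n \<Longrightarrow> y \<bullet> (poly_mat p F *\<^sub>v e) = c * coeff p (n - 1)"
    and "degree p \<le> n"
  shows "\<Phi> *\<^sub>v (poly_mat p F *\<^sub>v e) = poly_mat p S *\<^sub>v (\<Phi> *\<^sub>v e) + (c * coeff p n) \<cdot>\<^sub>v u"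
  using \<open>degree p \<le> n\<close>
proof (induction p)
  case 0
  then show ?case using F S \<Phi> u e by (auto intro!: eq_vecI)
next
  case (pCons a q)
  \<comment> \<open>Below degree \<open>n\<close> the top coefficient is zero, so the induction
    hypothesis is an exact intertwining. A defect can only enter with the last multiplication by
    \<open>F\<close>, weighted by the coefficient of \<open>q\<close> at \<open>n - 1\<close>, which
    is the coefficient of \<open>pCons a q\<close> at \<open>n\<close>.\<close>
  have dq: "degree q < n" using pCons.prems n by (cases "q = 0") auto
  then have "coeff q n = 0" by (simp add: coeff_eq_0)
  then have IH: "\<Phi> *\<^sub>v (poly_mat q F *\<^sub>v e) = poly_mat q S *\<^sub>v (\<Phi> *\<^sub>v e)"
    using pCons.IH dq F S \<Phi> u e by (auto intro!: eq_vecI simp del: index_mult_mat_vec)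
  define f where "f = poly_mat q F *\<^sub>v e"
  have f: "f \<in> carrier_vec n" unfolding f_def using F e by (intro mult_mat_vec_carrier[of _ n n]) simp_all
  have "\<Phi> *\<^sub>v (F *\<^sub>v f) = (\<Phi> * F) *\<^sub>v f"
    using F \<Phi> f by (simp add: assoc_mult_mat_vec_dim)
  also have "\<dots> = S *\<^sub>v (\<Phi> *\<^sub>v f) + (y \<bullet> f) \<cdot>\<^sub>v u"
    unfolding defect using S \<Phi> f u y by (simp add: mat_vec_distribs outer_prod_mult_vec)
  finally have step: "\<Phi> *\<^sub>v (F *\<^sub>v f) = S *\<^sub>v (poly_mat q S *\<^sub>v (\<Phi> *\<^sub>v e)) + (c * coeff q (n - 1)) \<cdot>\<^sub>v u"
    using IH dual[OF dq] by (simp add: f_def)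
  have "\<Phi> *\<^sub>v (poly_mat (pCons a q) F *\<^sub>v e) = a \<cdot>\<^sub>v (\<Phi> *\<^sub>v e) + \<Phi> *\<^sub>v (F *\<^sub>v f)"
    unfolding f_def poly_mat_pCons[OF F] using F \<Phi> e by (simp add: mat_vec_distribs)
  also have "\<dots> = poly_mat (pCons a q) S *\<^sub>v (\<Phi> *\<^sub>v e) + (c * coeff q (n - 1)) \<cdot>\<^sub>v u"
    unfolding step poly_mat_pCons[OF S] using S \<Phi> e u by (simp add: mat_vec_distribs assoc_add_vec_dim)
  also have "coeff q (n - 1) = coeff (pCons a q) n" using n by (simp add: coeff_pCons split: nat.split)
  finally show ?case .
qed

text \<open>The relation \<open>b p(-F) = p(F)\<close> is applied to \<open>e\<close> for the first
  conclusion and to \<open>R e\<close> for the second. The values there come from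
  \<open>krylov_chain\<close>, with intertwiners out of \<open>F\<close> whose target is annihilated
  by the polynomial in question or, for \<open>R\<close>, is \<open>- F\<close>.\<close>

lemma blaschke_vectors:
  fixes F G Q W R b :: "'a::field mat"
  assumes F: "F \<in> carrier_mat n n" and G: "G \<in> carrier_mat n n" and Q: "Q \<in> carrier_mat n n"
    and W: "W \<in> carrier_mat n n" and R: "R \<in> carrier_mat n n" and b: "b \<in> carrier_mat n n"
    and x: "x \<in> carrier_vec n" and y: "y \<in> carrier_vec n" and n: "n > 0"
    and GF: "G = F + outer_prod x y"
    and lyapQ: "G\<^sup>T * Q + Q * G = - outer_prod y y"
    and lyapR: "F * R + R * G = - outer_prod x y"
    and lyapW: "G * W + W * G\<^sup>T = - outer_prod q q"
    and q: "W *\<^sub>v y = q" "W\<^sup>T *\<^sub>v y = q" and QW: "Q * W = 1\<^sub>m n"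
    and deg: "degree p \<le> n" and lead: "coeff p n \<noteq> 0" and pG: "poly_mat p G = 0\<^sub>m n n"
    and det: "det (poly_mat p (- F)) \<noteq> 0"
    and bp: "b * poly_mat p (- F) = poly_mat p F"
    and u: "u = R *\<^sub>v q - x"
  shows "b *\<^sub>v (x + q) = (-1) ^ n \<cdot>\<^sub>v x" "b *\<^sub>v x = - ((-1) ^ n) \<cdot>\<^sub>v u"
proof -
  define r where "r = pcompose p [:0, -1:]"
  have r: "poly_mat r M = poly_mat p (- M)" if "M \<in> carrier_mat n n" for M
    unfolding r_def by (rule poly_mat_pcompose_uminus[OF that])
  have degr: "degree r \<le> n" unfolding r_def using deg by (simp add: degree_pcompose)
  define s :: 'a where "s = (-1) ^ n"
  have ss: "s * s = 1" by (simp add: s_def power_mult_distrib[symmetric])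
  have leadr: "coeff r n = s * coeff p n" by (simp add: r_def s_def coeff_pcompose_linear)
  define lc where "lc = coeff p n"
  have qc: "q \<in> carrier_vec n" using W y q(1)[symmetric] by simp
  have uc: "u \<in> carrier_vec n" using R qc x u by simp
  have GT: "G\<^sup>T \<in> carrier_mat n n" and F': "- F \<in> carrier_mat n n" and R1: "R *\<^sub>v x \<in> carrier_vec n"
    using G F R x by simp_all
  have Qdefect: "Q * F = (- G\<^sup>T) * Q + outer_prod (- (y + Q *\<^sub>v x)) y"
  proof -
    have "Q * F = Q * G - Q * outer_prod x y"
      unfolding GF using Q F x y by (intro eq_matI) (simp_all add: mat_distribs del: index_mult_mat(1))
    also have "Q * G = - outer_prod y y - G\<^sup>T * Q"
      unfolding lyapQ[symmetric] using Q G by (intro eq_matI) (simp_all del: index_mult_mat(1))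
    finally show ?thesis
      using Q F G x y by (intro eq_matI) (auto simp: mult_outer_prod mat_distribs algebra_simps
          simp del: index_mult_mat(1) index_mult_mat_vec)
  qed
  \<comment> \<open>The case \<open>c = 0\<close> of the chain has no defect at all, so
    \<open>Q p(-F) z = p(G)^T Q z = 0\<close>, and both \<open>Q\<close> and \<open>p(-F)\<close>
    can be cancelled.\<close>
  have obs: "z = 0\<^sub>v n" if z: "z \<in> carrier_vec n"
    and null: "\<And>p. degree p < n \<Longrightarrow> y \<bullet> (poly_mat p F *\<^sub>v z) = 0" for z
  proof -
    have "Q *\<^sub>v (poly_mat r F *\<^sub>v z) = poly_mat r (- G\<^sup>T) *\<^sub>v (Q *\<^sub>v z) + (0 * coeff r n) \<cdot>\<^sub>v (- (y + Q *\<^sub>v x))"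
      by (rule krylov_chain[OF F _ Q y _ z n Qdefect _ degr]) (use null GT Q x y in auto)
    also have "poly_mat r (- G\<^sup>T) = 0\<^sub>m n n"
      using GT by (simp add: r poly_mat_transpose[OF G] pG)
    finally have "Q *\<^sub>v (poly_mat p (- F) *\<^sub>v z) = 0\<^sub>v n"
      using Q z x y by (auto intro!: eq_vecI simp: zero_mult_vec_dim r[OF F] simp del: index_mult_mat_vec)
    moreover have "det Q \<noteq> 0" by (rule det_nonzero_if_inverse[OF Q W QW])
    ultimately have "poly_mat p (- F) *\<^sub>v z = 0\<^sub>v n"
      using det_0_iff_vec_prod_zero_field[OF Q] F z by (metis F' mult_mat_vec_carrier poly_mat_carrier)
    then show ?thesis
      using det_0_iff_vec_prod_zero_field[of "poly_mat p (- F)" n] F' z det by auto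
  qed
  obtain e where e: "e \<in> carrier_vec n"
    and dual: "\<And>p. degree p < n \<Longrightarrow> y \<bullet> (poly_mat p F *\<^sub>v e) = 1 * coeff p (n - 1)"
    using krylov_dual_vector[OF F y n obs] by (metis mult_1)
  have chain: "\<Phi> *\<^sub>v (poly_mat h F *\<^sub>v e) = poly_mat h S *\<^sub>v (\<Phi> *\<^sub>v e) + (1 * coeff h n) \<cdot>\<^sub>v t"
    if "S \<in> carrier_mat n n" "\<Phi> \<in> carrier_mat n n" "t \<in> carrier_vec n"
      "\<Phi> * F = S * \<Phi> + outer_prod t y" "degree h \<le> n" for S \<Phi> t h
    by (rule krylov_chain[OF F that(1,2) y that(3) e n that(4) dual that(5)])
  have I: "1\<^sub>m n \<in> carrier_mat n n" by simp

  \<comment> \<open>The identity intertwines \<open>F\<close> with \<open>G\<close> up to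
    \<open>-x y^T\<close>. Since \<open>p(G) = 0\<close>, only the rank-one term survives.\<close>
  have pF: "poly_mat p F *\<^sub>v e = - (lc \<cdot>\<^sub>v x)"
  proof -
    have "1\<^sub>m n * F = G * 1\<^sub>m n + outer_prod (- x) y"
      unfolding GF using F x y by (intro eq_matI) (auto simp del: index_mult_mat(1))
    from chain[OF G I _ this deg] have
      "1\<^sub>m n *\<^sub>v (poly_mat p F *\<^sub>v e) = poly_mat p G *\<^sub>v (1\<^sub>m n *\<^sub>v e) + (1 * coeff p n) \<cdot>\<^sub>v (- x)"
      using x by simp
    then show ?thesis unfolding pG using F e x
      by (auto intro!: eq_vecI simp: zero_mult_vec_dim lc_def simp del: index_mult_mat_vec)
  qed

  \<comment> \<open>By \<open>lyapW\<close>, \<open>G' W = - W G^T\<close>, so \<open>G'\<close> is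
    similar to \<open>- G^T\<close> and is annihilated by \<open>r(z) = p(-z)\<close>. Since
    \<open>F = G' - (x + q) y^T\<close>, it plays the role for \<open>r\<close> that
    \<open>G\<close> plays for \<open>p\<close>.\<close>
  define G' where "G' = G + outer_prod q y"
  have G': "G' \<in> carrier_mat n n" using G qc y by (simp add: G'_def)
  have rG': "poly_mat r G' = 0\<^sub>m n n"
  proof -
    have "G * W = - outer_prod q q - W * G\<^sup>T"
      unfolding lyapW[symmetric] using W G by (intro eq_matI) (simp_all del: index_mult_mat(1))
    moreover have "G' * W = G * W + outer_prod q q"
      unfolding G'_def using G W qc y by (simp add: mat_distribs outer_prod_mult q(2))
    ultimately have "G' * W = - (W * G\<^sup>T)"
      using G W qc by (intro eq_matI) (simp_all del: index_mult_mat(1))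
    then have "G' * W = W * (- G\<^sup>T)" using G W by simp
    then have "poly_mat r G' * W = W * poly_mat r (- G\<^sup>T)"
      using GT by (intro poly_mat_intertwine[OF G' _ W]) auto
    also have "\<dots> = 0\<^sub>m n n"
      using GT W by (simp add: r poly_mat_transpose[OF G] pG)
    finally have "poly_mat r G' * (W * Q) = 0\<^sub>m n n * Q"
      using G' W Q by (simp add: assoc_mult_mat_dim[symmetric] del: assoc_mult_mat)
    then show ?thesis
      using mat_mult_left_right_inverse[OF Q W QW] G' Q by simp
  qed
  have rF: "poly_mat r F *\<^sub>v e = - ((s * lc) \<cdot>\<^sub>v (x + q))"
  proof -
    have "1\<^sub>m n * F = G' * 1\<^sub>m n + outer_prod (- (x + q)) y"
      unfolding G'_def GF using F x y qc
      by (intro eq_matI) (auto simp: algebra_simps simp del: index_mult_mat(1))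
    from chain[OF G' I _ this degr] have
      "1\<^sub>m n *\<^sub>v (poly_mat r F *\<^sub>v e) = poly_mat r G' *\<^sub>v (1\<^sub>m n *\<^sub>v e) + (1 * coeff r n) \<cdot>\<^sub>v (- (x + q))"
      using x qc by simp
    then show ?thesis unfolding rG' leadr using F e x qc
      by (auto intro!: eq_vecI simp: zero_mult_vec_dim lc_def algebra_simps simp del: index_mult_mat_vec)
  qed

  have Rdefect: "R * F = (- F) * R + outer_prod (- (x + R *\<^sub>v x)) y"
  proof -
    have "R * F = R * G - R * outer_prod x y"
      unfolding GF using R F x y by (intro eq_matI) (simp_all add: mat_distribs del: index_mult_mat(1))
    also have "R * G = - outer_prod x y - F * R"
      unfolding lyapR[symmetric] using R F G by (intro eq_matI) (simp_all del: index_mult_mat(1))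
    finally show ?thesis
      using R F G x y by (intro eq_matI) (auto simp: mult_outer_prod mat_distribs algebra_simps
          simp del: index_mult_mat(1) index_mult_mat_vec)
  qed
  define f where "f = R *\<^sub>v e"
  have f: "f \<in> carrier_vec n" using R e by (simp add: f_def)
  have Rp: "R *\<^sub>v (poly_mat h F *\<^sub>v e) = poly_mat h (- F) *\<^sub>v f + coeff h n \<cdot>\<^sub>v (- (x + R *\<^sub>v x))"
    if "degree h \<le> n" for h
    unfolding f_def using chain[OF F' R _ Rdefect that] R x by simp
  \<comment> \<open>Applying \<open>R\<close> to \<open>pF\<close> gives \<open>- lc R x\<close>,
    which matches the \<open>R x\<close> part of the defect of \<open>R\<close>; only the multiple
    of \<open>x\<close> remains.\<close>
  have pRf: "poly_mat p (- F) *\<^sub>v f = lc \<cdot>\<^sub>v x"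
  proof -
    have "R *\<^sub>v (- (lc \<cdot>\<^sub>v x)) = - (lc \<cdot>\<^sub>v (R *\<^sub>v x))" using R x by (simp add: mat_vec_distribs)
    then have eq: "- (lc \<cdot>\<^sub>v (R *\<^sub>v x)) = poly_mat p (- F) *\<^sub>v f + lc \<cdot>\<^sub>v (- (x + R *\<^sub>v x))"
      using Rp[OF deg] pF by (simp add: lc_def)
    show ?thesis
    proof (rule eq_vecI)
      fix i assume "i < dim_vec (lc \<cdot>\<^sub>v x)"
      then show "(poly_mat p (- F) *\<^sub>v f) $ i = (lc \<cdot>\<^sub>v x) $ i"
        using arg_cong[OF eq, of "\<lambda>v. v $ i"] F R x f
        by (simp add: algebra_simps del: index_mult_mat_vec)
    qed (use F x in simp)
  qed
  \<comment> \<open>The same computation with \<open>r\<close>, where \<open>r(-F) = p(F)\<close>: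
    the \<open>R x\<close> terms cancel again, and \<open>R q - x\<close> is left.\<close>
  have rRf: "poly_mat p F *\<^sub>v f = - ((s * lc) \<cdot>\<^sub>v u)"
  proof -
    have "R *\<^sub>v (- ((s * lc) \<cdot>\<^sub>v (x + q))) = - ((s * lc) \<cdot>\<^sub>v (R *\<^sub>v x + R *\<^sub>v q))"
      using R x qc by (simp add: mat_vec_distribs)
    moreover have "poly_mat r (- F) = poly_mat p F" using F' by (simp add: r)
    ultimately have eq: "- ((s * lc) \<cdot>\<^sub>v (R *\<^sub>v x + R *\<^sub>v q)) =
        poly_mat p F *\<^sub>v f + (s * lc) \<cdot>\<^sub>v (- (x + R *\<^sub>v x))"
      using Rp[OF degr] rF leadr by (simp add: lc_def)
    show ?thesis
    proof (rule eq_vecI)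
      fix i assume "i < dim_vec (- ((s * lc) \<cdot>\<^sub>v u))"
      then show "(poly_mat p F *\<^sub>v f) $ i = (- ((s * lc) \<cdot>\<^sub>v u)) $ i"
        using arg_cong[OF eq, of "\<lambda>v. v $ i"] F R x f qc
        by (simp add: u algebra_simps del: index_mult_mat_vec)
    qed (use F uc in simp)
  qed
  have bp_vec: "b *\<^sub>v (poly_mat p (- F) *\<^sub>v g) = poly_mat p F *\<^sub>v g" if "g \<in> carrier_vec n" for g
    unfolding bp[symmetric] using b F that by (simp add: assoc_mult_mat_vec_dim)
  have lc0: "lc \<noteq> 0" using lead by (simp add: lc_def)
  show "b *\<^sub>v (x + q) = (-1) ^ n \<cdot>\<^sub>v x"
  proof (rule eq_vecI)
    fix i assume "i < dim_vec ((-1) ^ n \<cdot>\<^sub>v x)"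
    then have i: "i < n" using x by simp
    have "b *\<^sub>v (- ((s * lc) \<cdot>\<^sub>v (x + q))) = - (lc \<cdot>\<^sub>v x)"
      unfolding rF[symmetric] r[OF F] bp_vec[OF e] pF ..
    moreover have "b *\<^sub>v (- ((s * lc) \<cdot>\<^sub>v (x + q))) = - ((s * lc) \<cdot>\<^sub>v (b *\<^sub>v (x + q)))"
      using b x qc by (simp add: mult_mat_smult_vec_dim uminus_mult_mat_vec_dim)
    ultimately have "(- ((s * lc) \<cdot>\<^sub>v (b *\<^sub>v (x + q)))) $ i = (- (lc \<cdot>\<^sub>v x)) $ i" by simp
    then have "s * lc * (b *\<^sub>v (x + q)) $ i = lc * x $ i"
      using i b x by (simp del: index_mult_mat_vec)
    then have "s * (s * (b *\<^sub>v (x + q)) $ i) = s * x $ i" using lc0 by (simp del: index_mult_mat_vec)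
    then have "(b *\<^sub>v (x + q)) $ i = s * x $ i"
      unfolding mult.assoc[symmetric] ss by simp
    then show "(b *\<^sub>v (x + q)) $ i = ((-1) ^ n \<cdot>\<^sub>v x) $ i"
      using i x by (simp add: s_def del: index_mult_mat_vec)
  qed (use b x in simp)
  show "b *\<^sub>v x = - ((-1) ^ n) \<cdot>\<^sub>v u"
  proof (rule eq_vecI)
    fix i assume "i < dim_vec (- ((-1) ^ n) \<cdot>\<^sub>v u)"
    then have i: "i < n" using uc by simp
    have "b *\<^sub>v (lc \<cdot>\<^sub>v x) = - ((s * lc) \<cdot>\<^sub>v u)"
      unfolding pRf[symmetric] bp_vec[OF f] rRf ..
    moreover have "b *\<^sub>v (lc \<cdot>\<^sub>v x) = lc \<cdot>\<^sub>v (b *\<^sub>v x)"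
      using b x by (simp add: mult_mat_smult_vec_dim)
    ultimately have "(lc \<cdot>\<^sub>v (b *\<^sub>v x)) $ i = (- ((s * lc) \<cdot>\<^sub>v u)) $ i" by simp
    then have "lc * (b *\<^sub>v x) $ i = lc * (- s * u $ i)"
      using i b uc by (simp add: mult_ac del: index_mult_mat_vec)
    then have "(b *\<^sub>v x) $ i = - s * u $ i" using lc0 by (simp only: mult_cancel_left) simp
    then show "(b *\<^sub>v x) $ i = (- ((-1) ^ n) \<cdot>\<^sub>v u) $ i"
      using i uc by (simp add: s_def del: index_mult_mat_vec)
  qed (use b uc in simp)
qed

section \<open>Lyapunov equations\<close>

text \<open>Multiply the equation for \<open>Q\<close> by \<open>W\<close> from both sides.\<close>

lemma lyapunov_inverse:
  fixes G Q W :: "'a::comm_ring_1 mat"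
  assumes G: "G \<in> carrier_mat n n" and Q: "Q \<in> carrier_mat n n" and W: "W \<in> carrier_mat n n"
    and y: "y \<in> carrier_vec n"
    and lyap: "G\<^sup>T * Q + Q * G = - outer_prod y y" and QW: "Q * W = 1\<^sub>m n" and WQ: "W * Q = 1\<^sub>m n"
  shows "G * W + W * G\<^sup>T = - outer_prod (W *\<^sub>v y) (W\<^sup>T *\<^sub>v y)"
proof -
  have "W * (G\<^sup>T * Q + Q * G) * W = W * G\<^sup>T * (Q * W) + (W * Q) * (G * W)"
    using G Q W by (simp add: mat_distribs)
  also have "\<dots> = G * W + W * G\<^sup>T"
    unfolding QW WQ using G W by (simp add: comm_add_mat_dim)
  finally show ?thesis
    unfolding lyap using W y by (simp add: mat_distribs mult_outer_prod outer_prod_mult)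
qed

lemma lyapunov_conjugate:
  fixes F X b :: "'a::comm_ring_1 mat"
  assumes F: "F \<in> carrier_mat n n" and X: "X \<in> carrier_mat n n" and b: "b \<in> carrier_mat n n"
    and z: "z \<in> carrier_vec n"
    and comm: "F * b = b * F" and lyap: "F * X + X * F\<^sup>T = - outer_prod z z"
  shows "F * (b * X * b\<^sup>T) + (b * X * b\<^sup>T) * F\<^sup>T = - outer_prod (b *\<^sub>v z) (b *\<^sub>v z)"
proof -
  have commT: "b\<^sup>T * F\<^sup>T = F\<^sup>T * b\<^sup>T"
    using arg_cong[OF comm, of transpose_mat] F b by (simp add: transpose_mult_dim)
  have "F * (b * X * b\<^sup>T) = (F * b) * (X * b\<^sup>T)" using F b X by (simp add: assoc_mult_mat_dim)
  moreover have "(b * X * b\<^sup>T) * F\<^sup>T = b * X * (b\<^sup>T * F\<^sup>T)" using F b X by (simp add: assoc_mult_mat_dim)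
  ultimately have "F * (b * X * b\<^sup>T) + (b * X * b\<^sup>T) * F\<^sup>T = b * (F * X + X * F\<^sup>T) * b\<^sup>T"
    unfolding comm commT using F b X by (simp add: mat_distribs)
  then show ?thesis
    unfolding lyap using b z by (simp add: mat_distribs mult_outer_prod outer_prod_mult)
qed

text \<open>\<open>F\<close> is pushed through \<open>R\<close>, \<open>W\<close> and the transpose
  of \<open>R\<close> in turn, each passage leaving one rank-one term. With \<open>p = R q\<close>,
  completing the square in \<open>p p^T - x p^T - p x^T\<close> produces
  \<open>u = p - x\<close>.\<close>

lemma lyapunov_schur_complement:
  fixes F G R W :: "'a::comm_ring_1 mat"
  assumes F: "F \<in> carrier_mat n n" and G: "G \<in> carrier_mat n n"
    and R: "R \<in> carrier_mat n n" and W: "W \<in> carrier_mat n n"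
    and x: "x \<in> carrier_vec n" and y: "y \<in> carrier_vec n"
    and lyapR: "F * R + R * G = - outer_prod x y"
    and lyapW: "G * W + W * G\<^sup>T = - outer_prod q q"
    and q: "W *\<^sub>v y = q" "W\<^sup>T *\<^sub>v y = q" and u: "u = R *\<^sub>v q - x"
  shows "F * (R * W * R\<^sup>T) + (R * W * R\<^sup>T) * F\<^sup>T = outer_prod u u - outer_prod x x"
proof -
  define p where "p = R *\<^sub>v q"
  have qc: "q \<in> carrier_vec n" and pc: "p \<in> carrier_vec n"
    unfolding p_def q(1)[symmetric] using W R y by (auto intro!: carrier_vecI)
  have FR: "F * R = - outer_prod x y - R * G"
    unfolding lyapR[symmetric] using R F G by (intro eq_matI) (simp_all del: index_mult_mat(1))
  have lyapRT: "G\<^sup>T * R\<^sup>T + R\<^sup>T * F\<^sup>T = - outer_prod y x"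
    using arg_cong[OF lyapR, of transpose_mat] F R G x y
    by (simp add: transpose_distribs transpose_outer_prod comm_add_mat_dim)
  have GR: "G\<^sup>T * R\<^sup>T = - outer_prod y x - R\<^sup>T * F\<^sup>T"
    unfolding lyapRT[symmetric] using R F G by (intro eq_matI) (simp_all del: index_mult_mat(1))
  have GW: "G * W = - outer_prod q q - W * G\<^sup>T"
    unfolding lyapW[symmetric] using W G by (intro eq_matI) (simp_all del: index_mult_mat(1))
  have "F * (R * W * R\<^sup>T) = (F * R) * (W * R\<^sup>T)" using F R W by (simp add: assoc_mult_mat_dim)
  also have "\<dots> = - outer_prod x p - R * (G * W) * R\<^sup>T"
    unfolding FR using R W G x y
    by (simp add: mat_distribs outer_prod_mult transpose_distribs assoc_mult_mat_vec_dim q p_def)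
  also have "R * (G * W) * R\<^sup>T = - outer_prod p p - R * W * (G\<^sup>T * R\<^sup>T)"
    unfolding GW using R W G qc
    by (simp add: mat_distribs outer_prod_mult mult_outer_prod p_def)
  also have "R * W * (G\<^sup>T * R\<^sup>T) = - outer_prod p x - (R * W * R\<^sup>T) * F\<^sup>T"
    unfolding GR using R W F x y
    by (simp add: mat_distribs mult_outer_prod q p_def)
  finally have "F * (R * W * R\<^sup>T) =
      - outer_prod x p - (- outer_prod p p - (- outer_prod p x - R * W * R\<^sup>T * F\<^sup>T))" .
  then show ?thesis
    unfolding u p_def[symmetric] using R W F x pc
    by (intro eq_matI) (auto simp: algebra_simps simp del: index_mult_mat(1))
qed

section \<open>The Schur complement identities and the resulting similarity\<close>

lemma lyapunov_blaschke:
  fixes F G P Q W R b :: "'a::field mat"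
  assumes F: "F \<in> carrier_mat n n" and G: "G \<in> carrier_mat n n" and P: "P \<in> carrier_mat n n"
    and Q: "Q \<in> carrier_mat n n"
    and W: "W \<in> carrier_mat n n" and R: "R \<in> carrier_mat n n" and b: "b \<in> carrier_mat n n"
    and x: "x \<in> carrier_vec n" and y: "y \<in> carrier_vec n" and n: "n > 0"
    and unique: "\<And>D. D \<in> carrier_mat n n \<Longrightarrow> F * D + D * F\<^sup>T = 0\<^sub>m n n \<Longrightarrow> D = 0\<^sub>m n n"
    and GF: "G = F + outer_prod x y"
    and lyapP: "F * P + P * F\<^sup>T = - outer_prod x x"
    and lyapQ: "G\<^sup>T * Q + Q * G = - outer_prod y y"
    and lyapR: "F * R + R * G = - outer_prod x y"
    and QW: "Q * W = 1\<^sub>m n" and WT: "W\<^sup>T = W"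
    and deg: "degree p \<le> n" and lead: "coeff p n \<noteq> 0" and pG: "poly_mat p G = 0\<^sub>m n n"
    and det: "det (poly_mat p (- F)) \<noteq> 0"
    and bp: "b * poly_mat p (- F) = poly_mat p F" and comm: "F * b = b * F"
  shows "P - R * W * R\<^sup>T = b * P * b\<^sup>T" "b * (P + W) * b\<^sup>T = P"
proof -
  define q where "q = W *\<^sub>v y"
  define u where "u = R *\<^sub>v q - x"
  have q: "W *\<^sub>v y = q" "W\<^sup>T *\<^sub>v y = q" by (simp_all add: q_def WT)
  have qc: "q \<in> carrier_vec n" and uc: "u \<in> carrier_vec n"
    unfolding q_def u_def using W R x y by (auto intro!: carrier_vecI)
  have WQ: "W * Q = 1\<^sub>m n" by (rule mat_mult_left_right_inverse[OF Q W QW])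
  have lyapW: "G * W + W * G\<^sup>T = - outer_prod q q"
    using lyapunov_inverse[OF G Q W y lyapQ QW WQ] by (simp only: q)
  note vecs = blaschke_vectors[OF F G Q W R b x y n GF lyapQ lyapR lyapW q QW deg lead pG det bp u_def]
  have unique': "X = Y" if X: "X \<in> carrier_mat n n" and Y: "Y \<in> carrier_mat n n"
    and eq: "F * X + X * F\<^sup>T = F * Y + Y * F\<^sup>T" for X Y
  proof -
    have "F * (X - Y) + (X - Y) * F\<^sup>T = (F * X + X * F\<^sup>T) - (F * Y + Y * F\<^sup>T)"
      using F X Y by (intro eq_matI) (simp_all add: mat_distribs del: index_mult_mat(1))
    also have "\<dots> = 0\<^sub>m n n" unfolding eq using F Y by simp
    finally have "X - Y = 0\<^sub>m n n" by (rule unique[OF minus_carrier_mat[OF Y]])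
    then show ?thesis by (rule eq_if_minus_zero_mat[OF X Y])
  qed
  \<comment> \<open>The vector identities hold up to a sign depending on the parity of
    \<open>n\<close>; the outer squares do not see it.\<close>
  have sgn: "outer_prod (c \<cdot>\<^sub>v z) (c \<cdot>\<^sub>v z) = outer_prod z z"
    if "c * c = 1" for c :: 'a and z
  proof (rule eq_matI)
    fix i j assume "i < dim_row (outer_prod z z)" "j < dim_col (outer_prod z z)"
    moreover have "c * a * (c * d) = (c * c) * (a * d)" for a d :: 'a by (simp add: mult_ac)
    ultimately show "outer_prod (c \<cdot>\<^sub>v z) (c \<cdot>\<^sub>v z) $$ (i, j) = outer_prod z z $$ (i, j)"
      by (simp add: that)
  qed simp_all
  have s: "(-1) ^ n * (-1) ^ n = (1 :: 'a)" "- ((-1) ^ n) * - ((-1) ^ n) = (1 :: 'a)"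
    by (simp_all add: power_mult_distrib[symmetric])

  have M: "R * W * R\<^sup>T \<in> carrier_mat n n" using R W by auto
  show "P - R * W * R\<^sup>T = b * P * b\<^sup>T"
  proof (rule unique')
    have "F * (P - R * W * R\<^sup>T) + (P - R * W * R\<^sup>T) * F\<^sup>T =
        (F * P + P * F\<^sup>T) - (F * (R * W * R\<^sup>T) + (R * W * R\<^sup>T) * F\<^sup>T)"
      using F P R W by (intro eq_matI) (simp_all add: mat_distribs del: index_mult_mat(1))
    also have "\<dots> = - outer_prod u u"
      unfolding lyapP lyapunov_schur_complement[OF F G R W x y lyapR lyapW q u_def]
      using x uc by (intro eq_matI) simp_all
    also have "\<dots> = - outer_prod (b *\<^sub>v x) (b *\<^sub>v x)"
      unfolding vecs(2) sgn[OF s(2)] ..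
    also have "\<dots> = F * (b * P * b\<^sup>T) + (b * P * b\<^sup>T) * F\<^sup>T"
      by (rule lyapunov_conjugate[OF F P b x comm lyapP, symmetric])
    finally show "F * (P - R * W * R\<^sup>T) + (P - R * W * R\<^sup>T) * F\<^sup>T =
        F * (b * P * b\<^sup>T) + (b * P * b\<^sup>T) * F\<^sup>T" .
  qed (use P R W b M in auto)

  have PW: "P + W \<in> carrier_mat n n" and xq: "x + q \<in> carrier_vec n" using P W x qc by simp_all
  \<comment> \<open>Writing \<open>F = G - x y^T\<close> adds the cross terms
    \<open>-x q^T - q x^T\<close> to the equation for \<open>W\<close>; together with
    \<open>-x x^T\<close> from \<open>P\<close> they complete the square.\<close>
  have lyapPW: "F * (P + W) + (P + W) * F\<^sup>T = - outer_prod (x + q) (x + q)"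
  proof -
    have FG: "F = G - outer_prod x y"
      unfolding GF using F x y by (intro eq_matI) simp_all
    have FT: "F\<^sup>T = G\<^sup>T - outer_prod y x"
      unfolding FG using G x y by (simp add: transpose_minus_dim transpose_outer_prod)
    have "F * W + W * F\<^sup>T = (G * W + W * G\<^sup>T) - outer_prod x q - outer_prod q x"
      unfolding FT unfolding FG using G W x y qc
      by (intro eq_matI) (simp_all add: mat_distribs outer_prod_mult mult_outer_prod q del: index_mult_mat(1))
    moreover have "F * (P + W) + (P + W) * F\<^sup>T = (F * P + P * F\<^sup>T) + (F * W + W * F\<^sup>T)"
      using F P W by (intro eq_matI) (simp_all add: mat_distribs del: index_mult_mat(1))
    ultimately show ?thesis
      unfolding lyapP lyapW using x qc by (intro eq_matI) (simp_all add: algebra_simps)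
  qed
  show "b * (P + W) * b\<^sup>T = P"
  proof (rule unique')
    have "F * (b * (P + W) * b\<^sup>T) + (b * (P + W) * b\<^sup>T) * F\<^sup>T =
        - outer_prod (b *\<^sub>v (x + q)) (b *\<^sub>v (x + q))"
      by (rule lyapunov_conjugate[OF F PW b xq comm lyapPW])
    also have "\<dots> = - outer_prod x x"
      unfolding vecs(1) sgn[OF s(1)] ..
    finally show "F * (b * (P + W) * b\<^sup>T) + (b * (P + W) * b\<^sup>T) * F\<^sup>T = F * P + P * F\<^sup>T"
      unfolding lyapP .
  qed (use P W b in auto)
qed

text \<open>The identity \<open>sum\<close> exhibits a right inverse of \<open>b\<close>. It also
  shows that \<open>b^T P^-1 b\<close> inverts \<open>P + W\<close>, so by \<open>schur\<close> the
  conjugated matrix is \<open>I - P (P + W)^-1 = W (P + W)^-1\<close>. This inverts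
  \<open>I + P Q\<close> because \<open>(I + P Q) W = P + W\<close>.\<close>

lemma blaschke_conjugation:
  fixes P P' Q W b M :: "'a::field mat"
  assumes P: "P \<in> carrier_mat n n" and P': "P' \<in> carrier_mat n n" and Q: "Q \<in> carrier_mat n n"
    and W: "W \<in> carrier_mat n n" and b: "b \<in> carrier_mat n n" and M: "M \<in> carrier_mat n n"
    and PP': "P * P' = 1\<^sub>m n" and QW: "Q * W = 1\<^sub>m n"
    and schur: "P - M = b * P * b\<^sup>T" and sum: "b * (P + W) * b\<^sup>T = P"
  shows "invertible_mat b" "invertible_mat (minv b * P)"
    "minv b * P * (P' * M) * minv (minv b * P) = minv (1\<^sub>m n + P * Q)"
proof -
  define \<beta> where "\<beta> = (P + W) * b\<^sup>T * P'"
  have \<beta>: "\<beta> \<in> carrier_mat n n" using P W b P' by (auto simp: \<beta>_def)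
  have "b * \<beta> = b * (P + W) * b\<^sup>T * P'"
    unfolding \<beta>_def using P W b P' by (simp add: mat_distribs)
  then have b\<beta>: "b * \<beta> = 1\<^sub>m n" using sum PP' by simp
  then have \<beta>b: "\<beta> * b = 1\<^sub>m n" by (rule mat_mult_left_right_inverse[OF b \<beta>])
  have P'P: "P' * P = 1\<^sub>m n" by (rule mat_mult_left_right_inverse[OF P P' PP'])
  show "invertible_mat b" by (rule invertible_matI[OF b \<beta> b\<beta>])
  have minv_b: "minv b = \<beta>" by (rule minv_eq[OF b \<beta> b\<beta>])
  have Z: "\<beta> * P \<in> carrier_mat n n" and Z': "P' * b \<in> carrier_mat n n" using \<beta> P P' b by simp_all
  have "\<beta> * P * (P' * b) = \<beta> * (P * P') * b" using \<beta> P P' b by (simp add: assoc_mult_mat_dim)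
  then have ZZ': "\<beta> * P * (P' * b) = 1\<^sub>m n" using PP' \<beta>b \<beta> by simp
  show "invertible_mat (minv b * P)" unfolding minv_b by (rule invertible_matI[OF Z Z' ZZ'])
  have minv_Z: "minv (\<beta> * P) = P' * b" by (rule minv_eq[OF Z Z' ZZ'])

  \<comment> \<open>\<open>T\<close> is the inverse of \<open>P + W\<close>.\<close>
  define T where "T = b\<^sup>T * P' * b"
  have T: "T \<in> carrier_mat n n" using b P' by (auto simp: T_def)
  have "(P + W) * T = \<beta> * b"
    unfolding T_def \<beta>_def using P W b P' by (simp add: assoc_mult_mat_dim)
  then have PWT: "P * T + W * T = 1\<^sub>m n" using \<beta>b P W T by (simp add: add_mult_mat_dim)
  have M_eq: "M = P - b * P * b\<^sup>T"
    unfolding schur[symmetric] using P M by (intro eq_matI) simp_all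
  have "\<beta> * P * (P' * M) * (P' * b) = \<beta> * (P * P') * M * P' * b"
    using \<beta> P P' M b by (simp add: assoc_mult_mat_dim)
  also have "\<dots> = \<beta> * M * P' * b" unfolding PP' using \<beta> by simp
  also have "\<dots> = \<beta> * (P * P') * b - (\<beta> * b) * P * T"
    unfolding M_eq T_def using \<beta> P P' b by (simp add: mat_distribs)
  also have "\<dots> = 1\<^sub>m n - P * T" unfolding PP' \<beta>b using \<beta> \<beta>b P by simp
  also have "\<dots> = W * T"
    unfolding PWT[symmetric] using P W T by (intro eq_matI) (simp_all del: index_mult_mat(1))
  finally have lhs: "\<beta> * P * (P' * M) * (P' * b) = W * T" .
  have "(1\<^sub>m n + P * Q) * (W * T) = W * T + P * (Q * W) * T"
    using P Q W T by (simp add: mat_distribs)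
  also have "\<dots> = P * T + W * T"
    unfolding QW using P W T by (simp add: comm_add_mat_dim)
  also have "\<dots> = 1\<^sub>m n" by (rule PWT)
  finally have inv: "(1\<^sub>m n + P * Q) * (W * T) = 1\<^sub>m n" .
  have "minv (1\<^sub>m n + P * Q) = W * T"
    by (rule minv_eq[OF _ _ inv]) (use P Q W T in auto)
  then show "minv b * P * (P' * M) * minv (minv b * P) = minv (1\<^sub>m n + P * Q)"
    unfolding minv_b minv_Z lhs by simp
qed

section \<open>From the Stein to the Lyapunov equation\<close>

text \<open>Here \<open>K\<close> and \<open>L\<close> stand for \<open>(I + A)^-1\<close> and
  \<open>(I + B)^-1\<close>, so that \<open>I - 2 K\<close> and \<open>I - 2 L\<close> are the
  Cayley transforms of \<open>A\<close> and \<open>B\<close>.\<close>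

lemma cayley_stein:
  fixes A B C K L X :: "'a::comm_ring_1 mat"
  assumes A: "A \<in> carrier_mat n n" and B: "B \<in> carrier_mat n n" and C: "C \<in> carrier_mat n n"
    and K: "K \<in> carrier_mat n n" and L: "L \<in> carrier_mat n n" and X: "X \<in> carrier_mat n n"
    and stein: "X = A * X * B + C"
    and KA: "K * A = 1\<^sub>m n - K" and BL: "B * L = 1\<^sub>m n - L"
  shows "(1\<^sub>m n - 2 \<cdot>\<^sub>m K) * X + X * (1\<^sub>m n - 2 \<cdot>\<^sub>m L) = - (2 \<cdot>\<^sub>m (K * C * L))"
proof -
  \<comment> \<open>Multiplying the Stein equation by \<open>K\<close> and \<open>L\<close> turns
    its quadratic part into \<open>(I - K) X (I - L)\<close>; the product \<open>K X L\<close> then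
    cancels and only one-sided products remain.\<close>
  have "K * X * L = K * (A * X * B + C) * L" using stein by simp
  also have "\<dots> = (K * A) * X * (B * L) + K * C * L"
    using A B C K L X by (simp add: mat_distribs)
  also have "(K * A) * X * (B * L) = X - K * X - X * L + K * X * L"
    unfolding KA BL using K L X
    by (intro eq_matI) (simp_all add: mat_distribs del: index_mult_mat(1))
  finally have eq: "K * X * L = X - K * X - X * L + K * X * L + K * C * L" .
  show ?thesis
  proof (rule eq_matI)
    fix i j assume "i < dim_row (- (2 \<cdot>\<^sub>m (K * C * L)))" "j < dim_col (- (2 \<cdot>\<^sub>m (K * C * L)))"
    then have ij: "i < n" "j < n" using K L by simp_all
    have "(K * X * L) $$ (i, j) = (X - K * X - X * L + K * X * L + K * C * L) $$ (i, j)"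
      using eq by simp
    then have "(K * C * L) $$ (i, j) = (K * X) $$ (i, j) + (X * L) $$ (i, j) - X $$ (i, j)"
      using ij A B C K L X by (simp add: algebra_simps del: index_mult_mat(1))
    then have "2 * (K * C * L) $$ (i, j) = 2 * ((K * X) $$ (i, j) + (X * L) $$ (i, j) - X $$ (i, j))"
      by simp
    then show "((1\<^sub>m n - 2 \<cdot>\<^sub>m K) * X + X * (1\<^sub>m n - 2 \<cdot>\<^sub>m L)) $$ (i, j) = (- (2 \<cdot>\<^sub>m (K * C * L))) $$ (i, j)"
      using ij C K L X
      by (simp add: mat_distribs algebra_simps del: index_mult_mat(1) assoc_mult_mat)
  qed (use K L X in simp_all)
qed

text \<open>The converse direction for the homogeneous equation, through which uniqueness passes
  from Stein to Lyapunov equations. The hypothesis says \<open>D = K D + D K^T\<close>; multiplying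
  by \<open>A\<close> on the left and its transpose on the right removes \<open>K\<close>.\<close>

lemma cayley_lyapunov_imp_stein:
  fixes A K D :: "'a::field_char_0 mat"
  assumes A: "A \<in> carrier_mat n n" and K: "K \<in> carrier_mat n n" and D: "D \<in> carrier_mat n n"
    and AK: "A * K = 1\<^sub>m n - K"
    and lyap: "(1\<^sub>m n - 2 \<cdot>\<^sub>m K) * D + D * (1\<^sub>m n - 2 \<cdot>\<^sub>m K)\<^sup>T = 0\<^sub>m n n"
  shows "A * D * A\<^sup>T = D"
proof -
  have KAT: "K\<^sup>T * A\<^sup>T = 1\<^sub>m n - K\<^sup>T"
    using arg_cong[OF AK, of transpose_mat] A K by (simp add: transpose_distribs)
  have D_eq: "D = K * D + D * K\<^sup>T"
  proof (rule eq_matI)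
    fix i j assume "i < dim_row (K * D + D * K\<^sup>T)" "j < dim_col (K * D + D * K\<^sup>T)"
    then have ij: "i < n" "j < n" using K D by simp_all
    have "((1\<^sub>m n - 2 \<cdot>\<^sub>m K) * D + D * (1\<^sub>m n - 2 \<cdot>\<^sub>m K)\<^sup>T) $$ (i, j) = 0"
      unfolding lyap using ij by simp
    then have "2 * (D $$ (i, j) - (K * D) $$ (i, j) - (D * K\<^sup>T) $$ (i, j)) = 0"
      using ij K D by (simp add: mat_distribs transpose_distribs algebra_simps del: index_mult_mat(1))
    then have "D $$ (i, j) - (K * D) $$ (i, j) - (D * K\<^sup>T) $$ (i, j) = 0"
      by (metis mult_eq_0_iff zero_neq_numeral)
    then show "D $$ (i, j) = (K * D + D * K\<^sup>T) $$ (i, j)"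
      using ij K D by (simp add: algebra_simps del: index_mult_mat(1))
  qed (use K D in simp_all)
  have "A * D = A * (K * D + D * K\<^sup>T)" by (rule arg_cong[OF D_eq])
  also have "\<dots> = (A * K) * D + A * D * K\<^sup>T" using A K D by (simp add: mat_distribs)
  also have "\<dots> = (D - K * D) + A * D * K\<^sup>T"
    unfolding AK using A K D by (simp add: mat_distribs)
  also have "D - K * D = D * K\<^sup>T"
  proof (rule eq_matI)
    fix i j assume "i < dim_row (D * K\<^sup>T)" "j < dim_col (D * K\<^sup>T)"
    then show "(D - K * D) $$ (i, j) = (D * K\<^sup>T) $$ (i, j)"
      using arg_cong[OF D_eq, of "\<lambda>M. M $$ (i, j)"] K D by (simp add: algebra_simps del: index_mult_mat(1))
  qed (use K D in simp_all)
  finally have AD: "A * D = D * K\<^sup>T + A * D * K\<^sup>T" .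
  have "A * D * A\<^sup>T = (D * K\<^sup>T + A * D * K\<^sup>T) * A\<^sup>T" by (rule arg_cong[OF AD])
  also have "\<dots> = D * (K\<^sup>T * A\<^sup>T) + A * D * (K\<^sup>T * A\<^sup>T)"
    using A K D by (simp add: mat_distribs)
  also have "\<dots> = D - D * K\<^sup>T + (A * D - A * D * K\<^sup>T)"
    unfolding KAT using A K D by (simp add: mat_distribs)
  also have "\<dots> = D"
  proof (rule eq_matI)
    fix i j assume "i < dim_row D" "j < dim_col D"
    then show "(D - D * K\<^sup>T + (A * D - A * D * K\<^sup>T)) $$ (i, j) = D $$ (i, j)"
      using arg_cong[OF AD, of "\<lambda>M. M $$ (i, j)"] A K D
      by (simp add: algebra_simps del: index_mult_mat(1) assoc_mult_mat)
  qed (use A K D in simp_all)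
  finally show ?thesis .
qed

section \<open>Spectra, solvability of the Stein equations and Cayley transforms\<close>

lemma cspectrum_transpose:
  assumes "A \<in> carrier_mat n n"
  shows "cspectrum A\<^sup>T = cspectrum A"
proof -
  have "map_mat complex_of_real A \<in> carrier_mat n n" using assms by simp
  then show ?thesis
    by (simp add: cspectrum_def map_mat_transpose[symmetric] spectrum_root_char_poly[of _ n])
qed

lemma eigenvalue_imp_cspectrum:
  assumes A: "A \<in> carrier_mat n n" and "poly (char_poly A) x = 0"
  shows "complex_of_real x \<in> cspectrum A"
  using assms of_real_hom.eigenvalue_hom[OF A, of x]
  by (simp add: cspectrum_def spectrum_def eigenvalue_root_char_poly[OF A])

lemma cayley_inverse:
  fixes A :: "'a::field mat"
  assumes A: "A \<in> carrier_mat n n" and "poly (char_poly A) (-1) \<noteq> 0"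
  obtains K where "K \<in> carrier_mat n n" "K * A = 1\<^sub>m n - K" "A * K = 1\<^sub>m n - K" "det K \<noteq> 0"
proof -
  have "det (char_matrix A (-1)) \<noteq> 0"
    using assms eigenvalue_det[OF A] eigenvalue_root_char_poly[OF A] by blast
  moreover have "char_matrix A (-1) = 1\<^sub>m n + A"
    using A by (intro eq_matI) (auto simp: char_matrix_def)
  moreover have "1\<^sub>m n + A \<in> carrier_mat n n" using A by simp
  ultimately obtain K where K: "K \<in> carrier_mat n n" "(1\<^sub>m n + A) * K = 1\<^sub>m n" "K * (1\<^sub>m n + A) = 1\<^sub>m n"
    using inverse_mat_exists by metis
  have "A * K = (1\<^sub>m n + A) * K - K" "K * A = K * (1\<^sub>m n + A) - K"
    using A K(1) by (auto intro!: eq_matI simp: mat_distribs simp del: index_mult_mat(1))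
  moreover have "det K \<noteq> 0" using det_nonzero_if_inverse[OF K(1) _ K(3)] A by simp
  ultimately show ?thesis using that[OF K(1)] K(2,3) by simp
qed

lemma stein_ex1:
  fixes A :: "'a::field_char_0 mat"
  assumes A: "A \<in> carrier_mat n n" and B: "B \<in> carrier_mat n n" and C: "C \<in> carrier_mat n n"
    and det: "det (poly_mat (recip_char_poly B) A) \<noteq> 0"
  shows "\<exists>!X. X \<in> carrier_mat n n \<and> X = A * X * B + C"
proof -
  obtain X where X: "X \<in> carrier_mat n n" and X_eq: "X = A * X * B + C"
    using stein_exists[OF A B C det] by blast
  moreover have "Y = X" if Y: "Y \<in> carrier_mat n n" and Y_eq: "Y = A * Y * B + C" for Y
  proof -
    have "Y - X = (A * Y * B + C) - (A * X * B + C)" using X_eq Y_eq by simp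
    also have "\<dots> = A * (Y - X) * B"
      using A B C X Y by (intro eq_matI) (simp_all add: mat_distribs del: index_mult_mat(1))
    finally have "A * (Y - X) * B = Y - X" ..
    then have "Y - X = 0\<^sub>m n n" by (rule stein_unique[OF A B minus_carrier_mat[OF X] det])
    then show ?thesis by (rule eq_if_minus_zero_mat[OF Y X])
  qed
  ultimately show ?thesis by blast
qed

text \<open>With \<open>J = (I - F)^n = (2 K)^n\<close>, \<open>p(F)\<close> is
  \<open>char_poly B\<close> at \<open>A\<close> times \<open>J\<close>, and \<open>p(-F)\<close> is
  \<open>recip_char_poly B\<close> at \<open>A\<close> times \<open>J\<close>. The invertible factor
  \<open>J\<close> cancels in the quotient. For \<open>G\<close> in place of \<open>F\<close>,
  Cayley-Hamilton for \<open>B\<close> gives zero.\<close>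

lemma cayley_blaschke:
  fixes A B K L :: "'a::field_char_0 mat"
  assumes A: "A \<in> carrier_mat n n" and B: "B \<in> carrier_mat n n"
    and K: "K \<in> carrier_mat n n" "K * A = 1\<^sub>m n - K" "A * K = 1\<^sub>m n - K" "det K \<noteq> 0"
    and L: "L \<in> carrier_mat n n" "L * B = 1\<^sub>m n - L" "B * L = 1\<^sub>m n - L"
    and minus_one: "poly (char_poly B) (-1) \<noteq> 0"
    and det: "det (poly_mat (recip_char_poly B) A) \<noteq> 0"
  defines "p \<equiv> cayley_poly n (char_poly B)" and "F \<equiv> 1\<^sub>m n - 2 \<cdot>\<^sub>m K"
  shows "degree p \<le> n" "coeff p n \<noteq> 0" "poly_mat p (1\<^sub>m n - 2 \<cdot>\<^sub>m L) = 0\<^sub>m n n"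
    "det (poly_mat p (- F)) \<noteq> 0" "blaschke_mat B A \<in> carrier_mat n n"
    "blaschke_mat B A * poly_mat p (- F) = poly_mat p F"
    "F * blaschke_mat B A = blaschke_mat B A * F"
proof -
  have deg: "degree (char_poly B) = n" using degree_monic_char_poly[OF B] by simp
  show "degree p \<le> n" unfolding p_def by (rule degree_cayley_poly)
  show "coeff p n \<noteq> 0" unfolding p_def using deg minus_one by (simp add: coeff_cayley_poly)
  \<comment> \<open>For \<open>N = (I + M)^-1\<close>, both sides of the last equation equal
    \<open>2 (I - N) = 2 M N\<close>. The facts are stated generally because they serve both
    \<open>A\<close> and \<open>B\<close>.\<close>
  have moebius: "1\<^sub>m n - 2 \<cdot>\<^sub>m N \<in> carrier_mat n n"
    "M * (1\<^sub>m n - 2 \<cdot>\<^sub>m N) = (1\<^sub>m n - 2 \<cdot>\<^sub>m N) * M"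
    "1\<^sub>m n + (1\<^sub>m n - 2 \<cdot>\<^sub>m N) = M * (1\<^sub>m n - (1\<^sub>m n - 2 \<cdot>\<^sub>m N))"
    if M: "M \<in> carrier_mat n n" and N: "N \<in> carrier_mat n n"
      and NM: "N * M = 1\<^sub>m n - N" "M * N = 1\<^sub>m n - N" for M N :: "'a mat"
  proof -
    have *: "1\<^sub>m n - (1\<^sub>m n - 2 \<cdot>\<^sub>m N) = 2 \<cdot>\<^sub>m N" using N by (intro eq_matI) auto
    show "1\<^sub>m n - 2 \<cdot>\<^sub>m N \<in> carrier_mat n n" using N by (simp add: minus_carrier_mat)
    show "M * (1\<^sub>m n - 2 \<cdot>\<^sub>m N) = (1\<^sub>m n - 2 \<cdot>\<^sub>m N) * M"
      using M N by (simp add: mat_distribs NM)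
    show "1\<^sub>m n + (1\<^sub>m n - 2 \<cdot>\<^sub>m N) = M * (1\<^sub>m n - (1\<^sub>m n - 2 \<cdot>\<^sub>m N))"
      unfolding * using M N by (simp add: mult_smult_mat_dim NM) (intro eq_matI, auto)
  qed
  have "poly_mat p (1\<^sub>m n - 2 \<cdot>\<^sub>m L) = poly_mat (char_poly B) B * (1\<^sub>m n - (1\<^sub>m n - 2 \<cdot>\<^sub>m L)) ^\<^sub>m n"
    unfolding p_def by (rule poly_mat_cayley_poly(1)[OF B moebius[OF B L]]) (simp add: deg)
  then show "poly_mat p (1\<^sub>m n - 2 \<cdot>\<^sub>m L) = 0\<^sub>m n n"
    using L(1) by (simp add: Cayley_Hamilton[OF B] left_mult_zero_mat[of _ n n] minus_carrier_mat)
  define S where "S = poly_mat (recip_char_poly B) A"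
  define J where "J = (1\<^sub>m n - F) ^\<^sub>m n"
  have F: "F \<in> carrier_mat n n" unfolding F_def by (rule moebius[OF A K(1-3)])
  have J: "J \<in> carrier_mat n n" and S: "S \<in> carrier_mat n n"
    using A F by (simp_all add: J_def S_def minus_carrier_mat)
  note cayley = poly_mat_cayley_poly[OF A moebius[OF A K(1-3)], of "char_poly B" n, folded F_def p_def J_def]
  have refl: "reflect_at n (char_poly B) = recip_char_poly B"
    using reflect_at_degree[of "char_poly B"] deg by (simp add: recip_char_poly_eq[OF B])
  have pF: "poly_mat p F = poly_mat (char_poly B) A * J" and pF': "poly_mat p (- F) = S * J"
    using cayley deg refl by (simp_all add: S_def)
  have "1\<^sub>m n - F = 2 \<cdot>\<^sub>m K" unfolding F_def using K by (intro eq_matI) auto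
  then have "det J \<noteq> 0" unfolding J_def using K by (simp add: det_pow_mat[of _ n])
  then show det': "det (poly_mat p (- F)) \<noteq> 0"
    unfolding pF' det_mult[OF S J] using det by (simp add: S_def)
  obtain N where N: "N \<in> carrier_mat n n" "S * N = 1\<^sub>m n" "N * S = 1\<^sub>m n"
    using inverse_mat_exists[OF S] det by (auto simp: S_def)
  have b_eq: "blaschke_mat B A = poly_mat (char_poly B) A * N"
    unfolding blaschke_mat_def S_def[symmetric] by (simp add: minv_eq[OF S N(1,2)])
  show b: "blaschke_mat B A \<in> carrier_mat n n"
    unfolding b_eq by (rule mult_carrier_mat[OF poly_mat_carrier[OF A] N(1)])
  have "blaschke_mat B A * poly_mat p (- F) = poly_mat (char_poly B) A * (N * S) * J"
    unfolding b_eq pF' using A N(1) S J by (simp add: assoc_mult_mat_dim)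
  then show "blaschke_mat B A * poly_mat p (- F) = poly_mat p F"
    unfolding pF N(3) using A J by simp
  have SF: "poly_mat q A * F = F * poly_mat q A" for q
    by (rule poly_mat_intertwine[OF A A F]) (use moebius(2)[OF A K(1-3)] in \<open>simp add: F_def\<close>)
  have "F * N = (N * S) * F * N" unfolding N(3) using F N(1) by simp
  also have "\<dots> = N * (S * F) * N" using F N(1) S by (simp add: assoc_mult_mat_dim)
  also have "\<dots> = N * F * (S * N)" unfolding S_def SF using F N(1) A by (simp add: assoc_mult_mat_dim)
  also have "\<dots> = N * F" unfolding N(2) using F N(1) by simp
  finally have FN: "F * N = N * F" .
  have "F * blaschke_mat B A = (F * poly_mat (char_poly B) A) * N"
    unfolding b_eq using F A N(1) by (simp add: assoc_mult_mat_dim)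
  also have "\<dots> = poly_mat (char_poly B) A * (F * N)"
    unfolding SF[symmetric] using F A N(1) by (simp add: assoc_mult_mat_dim)
  also have "\<dots> = blaschke_mat B A * F"
    unfolding FN b_eq using F A N(1) by (simp add: assoc_mult_mat_dim)
  finally show "F * blaschke_mat B A = blaschke_mat B A * F" .
qed

section \<open>Real Stein equations and the similarity to the inverse of
  \<open>I + P Q\<close>\<close>

theorem proposition12:
  fixes n :: nat and A A2 :: "real mat" and v w :: "real vec"
  assumes "n \<ge> 1"
    and "A \<in> carrier_mat n n" and "v \<in> carrier_vec n" and "w \<in> carrier_vec n"
    and "A2 = A + outer_prod v w"
    and "\<forall>a\<in>cspectrum A \<union> cspectrum A2. \<forall>b\<in>cspectrum A \<union> cspectrum A2. a * b \<noteq> 1"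
  shows
    "(\<exists>!P. P \<in> carrier_mat n n \<and> P = A * P * A\<^sup>T + outer_prod v v) \<and>
     (\<exists>!Q. Q \<in> carrier_mat n n \<and> Q = A2\<^sup>T * Q * A2 + outer_prod w w) \<and>
     (\<exists>!R. R \<in> carrier_mat n n \<and> R = A * R * A2 + outer_prod v w) \<and>
     invertible_mat (poly_mat (recip_char_poly A2) A) \<and>
     (\<forall>P Q R Z.
        P \<in> carrier_mat n n \<and> P = A * P * A\<^sup>T + outer_prod v v \<and>
        Q \<in> carrier_mat n n \<and> Q = A2\<^sup>T * Q * A2 + outer_prod w w \<and>
        R \<in> carrier_mat n n \<and> R = A * R * A2 + outer_prod v w \<and>
        invertible_mat P \<and> invertible_mat Q \<and> invertible_mat (1\<^sub>m n + P * Q) \<and>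
        resultant (char_poly A) (char_poly A2) \<noteq> 0 \<and>
        Z = minv (blaschke_mat A2 A) * P
        \<longrightarrow> invertible_mat (blaschke_mat A2 A) \<and>
            invertible_mat Z \<and>
            Z * (minv P * R * minv Q * R\<^sup>T) * minv Z = minv (1\<^sub>m n + P * Q))"
proof -
  note A = assms(2) and v = assms(3) and w = assms(4) and A2_eq = assms(5) and spec = assms(6)
  have A2: "A2 \<in> carrier_mat n n" unfolding A2_eq using A v w by simp
  have AT: "A\<^sup>T \<in> carrier_mat n n" and A2T: "A2\<^sup>T \<in> carrier_mat n n" using A A2 by simp_all
  note spec_T = cspectrum_transpose[OF A] cspectrum_transpose[OF A2]
  \<comment> \<open>Products across the two spectra control the equation for \<open>R\<close>,
    products within one spectrum those for \<open>P\<close> and \<open>Q\<close>, since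
    transposition preserves the spectrum.\<close>
  have detR: "det (poly_mat (recip_char_poly A2) A) \<noteq> 0"
    using spec by (intro det_recip_char_poly_nonzero[OF A A2]) auto
  have detP: "det (poly_mat (recip_char_poly A\<^sup>T) A) \<noteq> 0"
    using spec by (intro det_recip_char_poly_nonzero[OF A AT]) (auto simp: spec_T)
  have detQ: "det (poly_mat (recip_char_poly A2) A2\<^sup>T) \<noteq> 0"
    using spec by (intro det_recip_char_poly_nonzero[OF A2T A2]) (auto simp: spec_T)
  have vv: "outer_prod v v \<in> carrier_mat n n" and ww: "outer_prod w w \<in> carrier_mat n n"
    and vw: "outer_prod v w \<in> carrier_mat n n" using v w by simp_all
  note exP = stein_ex1[OF A AT vv detP] and exQ = stein_ex1[OF A2T A2 ww detQ]
    and exR = stein_ex1[OF A A2 vw detR]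
  have invS: "invertible_mat (poly_mat (recip_char_poly A2) A)"
    using inverse_mat_exists[OF _ detR] invertible_matI A by (metis poly_mat_carrier)

  \<comment> \<open>The self-pair of -1 has product 1, so -1 is excluded from both spectra.\<close>
  have minus_one: "poly (char_poly M) (-1) \<noteq> 0"
    if "M \<in> carrier_mat n n" "cspectrum M \<subseteq> cspectrum A \<union> cspectrum A2" for M
  proof
    assume "poly (char_poly M) (-1) = 0"
    then have "complex_of_real (-1) \<in> cspectrum M" by (rule eigenvalue_imp_cspectrum[OF that(1)])
    then have "complex_of_real (-1) * complex_of_real (-1) \<noteq> 1" using spec that(2) by blast
    then show False by simp
  qed
  have A1: "poly (char_poly A) (-1) \<noteq> 0" and A21: "poly (char_poly A2) (-1) \<noteq> 0"
    using minus_one A A2 by auto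
  obtain K where K: "K \<in> carrier_mat n n" "K * A = 1\<^sub>m n - K" "A * K = 1\<^sub>m n - K" "det K \<noteq> 0"
    using cayley_inverse[OF A A1] .
  obtain L where L: "L \<in> carrier_mat n n" "L * A2 = 1\<^sub>m n - L" "A2 * L = 1\<^sub>m n - L" "det L \<noteq> 0"
    using cayley_inverse[OF A2 A21] .
  define F where "F = 1\<^sub>m n - 2 \<cdot>\<^sub>m K"
  define G where "G = 1\<^sub>m n - 2 \<cdot>\<^sub>m L"
  \<comment> \<open>The factor \<open>sqrt 2\<close> in \<open>x\<close> and in \<open>y\<close>
    splits the 2 on the right-hand side of \<open>cayley_stein\<close> evenly, so that all three
    Lyapunov equations have plain outer products.\<close>
  define x where "x = sqrt 2 \<cdot>\<^sub>v (K *\<^sub>v v)"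
  define y where "y = sqrt 2 \<cdot>\<^sub>v (L\<^sup>T *\<^sub>v w)"
  have F: "F \<in> carrier_mat n n" and G: "G \<in> carrier_mat n n"
    using K L by (simp_all add: F_def G_def minus_carrier_mat)
  have x: "x \<in> carrier_vec n" and y: "y \<in> carrier_vec n"
    unfolding x_def y_def using K L v w by (auto intro!: carrier_vecI)
  have FT: "F\<^sup>T = 1\<^sub>m n - 2 \<cdot>\<^sub>m K\<^sup>T" and GT: "G\<^sup>T = 1\<^sub>m n - 2 \<cdot>\<^sub>m L\<^sup>T"
    using K L by (simp_all add: F_def G_def transpose_distribs)
  have KT: "K\<^sup>T \<in> carrier_mat n n" "A\<^sup>T * K\<^sup>T = 1\<^sub>m n - K\<^sup>T"
    using arg_cong[OF K(2), of transpose_mat] A K(1) by (simp_all add: transpose_distribs)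
  have LT: "L\<^sup>T \<in> carrier_mat n n" "L\<^sup>T * A2\<^sup>T = 1\<^sub>m n - L\<^sup>T"
    using arg_cong[OF L(3), of transpose_mat] A2 L(1) by (simp_all add: transpose_distribs)
  have outer2: "outer_prod (sqrt 2 \<cdot>\<^sub>v s) (sqrt 2 \<cdot>\<^sub>v t) = 2 \<cdot>\<^sub>m outer_prod s t" for s t :: "real vec"
  proof (rule eq_matI)
    fix i j assume "i < dim_row (2 \<cdot>\<^sub>m outer_prod s t)" "j < dim_col (2 \<cdot>\<^sub>m outer_prod s t)"
    moreover have "sqrt 2 * a * (sqrt 2 * c) = (sqrt 2 * sqrt 2) * (a * c)" for a c :: real
      by (simp only: mult_ac)
    ultimately show "outer_prod (sqrt 2 \<cdot>\<^sub>v s) (sqrt 2 \<cdot>\<^sub>v t) $$ (i, j) = (2 \<cdot>\<^sub>m outer_prod s t) $$ (i, j)"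
      by simp
  qed simp_all
  have GF: "G = F + outer_prod x y"
  proof -
    \<comment> \<open>The difference of two resolvents:
      \<open>K (A2 - A) L = K (I - L) - (I - K) L = K - L\<close>.\<close>
    have "K * outer_prod v w * L = K * (A2 - A) * L"
      unfolding A2_eq using A v w by (intro arg_cong[of _ _ "\<lambda>M. K * M * L"] eq_matI) auto
    also have "\<dots> = K * (A2 * L) - (K * A) * L"
      using K(1) L(1) A A2 by (simp add: mat_distribs)
    also have "\<dots> = K - L"
      unfolding K(2) L(3) using K(1) L(1)
      by (intro eq_matI) (simp_all add: mat_distribs del: index_mult_mat(1))
    finally have "outer_prod x y = 2 \<cdot>\<^sub>m (K - L)"
      unfolding x_def y_def outer2 using K(1) L(1) v w by (simp add: mult_outer_prod outer_prod_mult)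
    then show ?thesis
      unfolding F_def G_def using K(1) L(1) by (intro eq_matI) auto
  qed
  have unique: "D = 0\<^sub>m n n" if D: "D \<in> carrier_mat n n" and "F * D + D * F\<^sup>T = 0\<^sub>m n n" for D
    using stein_unique[OF A AT D detP] cayley_lyapunov_imp_stein[OF A K(1) D K(3)] that(2)
    unfolding F_def by blast
  define b where "b = blaschke_mat A2 A"
  note blaschke = cayley_blaschke[OF A A2 K L(1-3) A21 detR, folded F_def G_def b_def]

  have main: "invertible_mat b \<and> invertible_mat (minv b * P) \<and>
      minv b * P * (minv P * R * minv Q * R\<^sup>T) * minv (minv b * P) = minv (1\<^sub>m n + P * Q)"
    if P: "P \<in> carrier_mat n n" and steinP: "P = A * P * A\<^sup>T + outer_prod v v"
      and Q: "Q \<in> carrier_mat n n" and steinQ: "Q = A2\<^sup>T * Q * A2 + outer_prod w w"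
      and R: "R \<in> carrier_mat n n" and steinR: "R = A * R * A2 + outer_prod v w"
      and invP: "invertible_mat P" and invQ: "invertible_mat Q" for P Q R
  proof -
    have lyapP: "F * P + P * F\<^sup>T = - outer_prod x x"
      using cayley_stein[OF A AT vv K(1) KT(1) P steinP K(2) KT(2)] K(1) v
      unfolding FT unfolding F_def x_def outer2 by (simp add: mult_outer_prod outer_prod_mult)
    have lyapQ: "G\<^sup>T * Q + Q * G = - outer_prod y y"
      using cayley_stein[OF A2T A2 ww LT(1) L(1) Q steinQ LT(2) L(3)] L(1) w
      unfolding GT unfolding G_def y_def outer2 by (simp add: mult_outer_prod outer_prod_mult)
    have lyapR: "F * R + R * G = - outer_prod x y"
      using cayley_stein[OF A A2 vw K(1) L(1) R steinR K(2) L(3)] K(1) L(1) v w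
      unfolding F_def G_def x_def y_def outer2 by (simp add: mult_outer_prod outer_prod_mult)
    obtain P' where P': "P' \<in> carrier_mat n n" "P * P' = 1\<^sub>m n" "minv P = P'"
      using invertible_matE[OF P invP] by metis
    obtain W where W: "W \<in> carrier_mat n n" "Q * W = 1\<^sub>m n" "W * Q = 1\<^sub>m n" "minv Q = W"
      using invertible_matE[OF Q invQ] by metis
    \<comment> \<open>The transpose of \<open>Q\<close> solves the same Stein equation, so
      uniqueness makes \<open>Q\<close>, and hence its inverse \<open>W\<close>, symmetric. This is
      what makes \<open>W y\<close> and \<open>W^T y\<close> the same vector.\<close>
    have "Q\<^sup>T = (A2\<^sup>T * Q * A2 + outer_prod w w)\<^sup>T" using steinQ by simp
    also have "\<dots> = A2\<^sup>T * Q\<^sup>T * A2 + outer_prod w w"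
      using A2 Q w by (simp add: transpose_distribs transpose_outer_prod assoc_mult_mat_dim)
    finally have "Q\<^sup>T = Q" using exQ Q steinQ by (metis transpose_carrier_mat)
    have WT: "W\<^sup>T = W"
    proof -
      have "Q * W\<^sup>T = 1\<^sub>m n"
        using arg_cong[OF W(3), of transpose_mat] W(1) Q \<open>Q\<^sup>T = Q\<close> by (simp add: transpose_mult_dim)
      then have "minv Q = W\<^sup>T" using W(1) by (intro minv_eq[OF Q]) auto
      then show ?thesis using W(4) by simp
    qed
    have n: "n > 0" using assms(1) by simp
    note lb = lyapunov_blaschke[OF F G P Q W(1) R blaschke(5) x y n unique GF lyapP lyapQ lyapR W(2) WT
        blaschke(1-4,6,7)]
    have M: "R * W * R\<^sup>T \<in> carrier_mat n n" using R W(1) by auto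
    note conj = blaschke_conjugation[OF P P'(1) Q W(1) blaschke(5) M P'(2) W(2) lb]
    have assoc: "minv P * R * minv Q * R\<^sup>T = P' * (R * W * R\<^sup>T)"
      unfolding P'(3) W(4) using P'(1) R W(1) by (simp add: assoc_mult_mat_dim)
    show ?thesis unfolding assoc by (intro conjI conj)
  qed
  show ?thesis
  proof (intro conjI[OF exP] conjI[OF exQ] conjI[OF exR] conjI[OF invS] allI impI; elim conjE)
    fix P Q R Z
    assume hyps: "P \<in> carrier_mat n n" "P = A * P * A\<^sup>T + outer_prod v v"
      "Q \<in> carrier_mat n n" "Q = A2\<^sup>T * Q * A2 + outer_prod w w"
      "R \<in> carrier_mat n n" "R = A * R * A2 + outer_prod v w" "invertible_mat P" "invertible_mat Q"
      and Z: "Z = minv (blaschke_mat A2 A) * P"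
    show "invertible_mat (blaschke_mat A2 A) \<and> invertible_mat Z \<and>
        Z * (minv P * R * minv Q * R\<^sup>T) * minv Z = minv (1\<^sub>m n + P * Q)"
      unfolding Z by (rule main[OF hyps, unfolded b_def])
  qed
qed

end
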